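(* Let $X$ be a Hilbert space, $H=X\times X$ and $U=X$. Assume that the operator $-A$ is positive self-adjoint on $H$, with sequence of eigenvalues $\{\lambda_{k,i}:\ i=1,2,\ k\ge1\}$ sorted in the order $$\cdots<\lambda_{k,1}<\lambda_{k,2}<\lambda_{k+1,1}<\cdots,$$ and that the corresponding eigenfunctions have the form $\varphi_{k,i}=\varphi_ke_i$, where $(e_1,e_2)$ is the canonical basis of $\mathbb R^2$ and $\{\varphi_k:\ k\ge1\}$ is a Hilbert basis of $X$. Let $B$ be the bounded control operator $B=\begin{pmatrix}b_1\\ {b_2}\end{pmatrix}$ with $(b_1,b_2)\in\mathbb R^2$, i.e. $Bu=(b_1u,b_2u)$ for $u\in X$. Let $T^*\in[0,+\infty]$ be defined as in the context. Then: (i) if $T^*>0$ and $T<T^*$, the control system $y'=Ay+Bu$ is not null controllable in time $T$; (ii) if $T^*<+\infty$ and $T>T^*$, the control system $y'=Ay+Bu$ is null controllable in time $T$.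
   Context: The control system is $y'(t)=Ay(t)+Bu(t)$, $t\ge0$, $y(0)=y_0\in H$, with controls $u\in L^2(0,T;U)$. It is null controllable in time $T>0$ if for every $y_0\in H$ there exists $u\in L^2(0,T;U)$ such that the associated (mild) solution satisfies $y(T)=0$. The vector $\varphi_ke_i\in X\times X$ is the element whose $i$-th component is $\varphi_k$ and whose other component is $0$. Definition of $T^*$: $T^*$ is the infimum of the set of $T>0$ for which there exists $C_T>0$ such that for all $y\in D(A^* )$ and all $\lambda\in\mathbb C$ with $\mathrm{Re}(\lambda)>0$, $$\|y\|^2\le C_Te^{2T\mathrm{Re}(\lambda)}\left(\frac{\|(A^*+\lambda)y\|^2}{\mathrm{Re}(\lambda)^2}+\frac{\|B^*y\|_U^2}{\mathrm{Re}(\lambda)}\right),$$ and $T^*=+\infty$ if this set is empty. *)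

theory Defs
  imports "HOL-Analysis.Analysis"
begin

section \<open>Complex Hilbert spaces\<close>

text \<open>
  The library has real inner product spaces only. A complex inner product is added on top of a
  real one: the inherited norm is the one induced by the real inner product, which the last axiom
  identifies with the real part of the complex inner product. The complex inner product is
  linear in its first argument.
\<close>

class complex_inner = real_inner +
  fixes scaleC :: "complex \<Rightarrow> 'a \<Rightarrow> 'a"  (infixr "*\<^sub>C" 75)
    and cinner :: "'a \<Rightarrow> 'a \<Rightarrow> complex"
  assumes scaleC_add_right: "a *\<^sub>C (x + y) = a *\<^sub>C x + a *\<^sub>C y"
    and scaleC_add_left: "(a + b) *\<^sub>C x = a *\<^sub>C x + b *\<^sub>C x"
    and scaleC_scaleC: "a *\<^sub>C b *\<^sub>C x = (a * b) *\<^sub>C x"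
    and scaleC_of_real: "complex_of_real r *\<^sub>C x = r *\<^sub>R x"
    and cinner_commute: "cinner x y = cnj (cinner y x)"
    and cinner_add_left: "cinner (x + y) z = cinner x z + cinner y z"
    and cinner_scaleC_left: "cinner (a *\<^sub>C x) y = a * cinner x y"
    and Re_cinner: "Re (cinner x y) = inner x y"

class complex_hilbert = complex_inner + complete_space

interpretation complex_vector: vector_space "scaleC :: complex \<Rightarrow> 'a \<Rightarrow> 'a::complex_inner"
proof
  fix x :: 'a
  show "1 *\<^sub>C x = x"
    using scaleC_of_real[of 1 x] by simp
qed (simp_all add: scaleC_add_right scaleC_add_left scaleC_scaleC)

instantiation prod :: (complex_inner, complex_inner) complex_inner
begin

definition scaleC_prod_def: "a *\<^sub>C p = (a *\<^sub>C fst p, a *\<^sub>C snd p)"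

definition cinner_prod_def: "cinner p q = cinner (fst p) (fst q) + cinner (snd p) (snd q)"

instance
proof
  fix x y :: "'a \<times> 'b"
  show "cinner x y = cnj (cinner y x)"
    using cinner_commute[of "fst x" "fst y"] cinner_commute[of "snd x" "snd y"]
    by (simp add: cinner_prod_def)
qed (simp_all add: scaleC_prod_def cinner_prod_def scaleC_add_right scaleC_add_left
      scaleC_scaleC scaleC_of_real scaleR_prod_def cinner_add_left cinner_scaleC_left
      Re_cinner inner_prod_def algebra_simps)

end

instance prod :: (complex_hilbert, complex_hilbert) complex_hilbert ..

definition hilbert_basis_on :: "'i set \<Rightarrow> ('i \<Rightarrow> 'a::complex_hilbert) \<Rightarrow> bool" where
  "hilbert_basis_on I \<phi> \<longleftrightarrow>
     (\<forall>j\<in>I. \<forall>k\<in>I. cinner (\<phi> j) (\<phi> k) = (if j = k then 1 else 0)) \<and>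
     closure (complex_vector.span (\<phi> ` I)) = UNIV"


section \<open>Unbounded operators\<close>

text \<open>
  An unbounded operator is given by a domain \<open>D\<close> and a total function \<open>A\<close>
  whose values outside \<open>D\<close> are never used.
\<close>

definition densely_defined_op :: "'a::complex_hilbert set \<Rightarrow> ('a \<Rightarrow> 'b::complex_hilbert) \<Rightarrow> bool" where
  "densely_defined_op D A \<longleftrightarrow>
     complex_vector.subspace D \<and> closure D = UNIV \<and>
     (\<forall>x\<in>D. \<forall>y\<in>D. A (x + y) = A x + A y) \<and>
     (\<forall>c. \<forall>x\<in>D. A (c *\<^sub>C x) = c *\<^sub>C A x)"

definition adj_dom :: "'a::complex_hilbert set \<Rightarrow> ('a \<Rightarrow> 'b::complex_hilbert) \<Rightarrow> 'b set" where
  "adj_dom D A = {y. \<exists>z. \<forall>x\<in>D. cinner (A x) y = cinner x z}"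

text \<open>
  For dense \<open>D\<close> and \<open>y \<in> adj_dom D A\<close> the vector described below is unique.
\<close>

definition adj :: "'a::complex_hilbert set \<Rightarrow> ('a \<Rightarrow> 'b::complex_hilbert) \<Rightarrow> 'b \<Rightarrow> 'a" where
  "adj D A y = (THE z. \<forall>x\<in>D. cinner (A x) y = cinner x z)"

definition self_adjoint_op :: "'a::complex_hilbert set \<Rightarrow> ('a \<Rightarrow> 'a) \<Rightarrow> bool" where
  "self_adjoint_op D A \<longleftrightarrow>
     densely_defined_op D A \<and> adj_dom D A = D \<and> (\<forall>y\<in>D. adj D A y = A y)"

text \<open>Positivity is meant in the wide sense; the inner product is real by self-adjointness.\<close>

definition positive_self_adjoint_op :: "'a::complex_hilbert set \<Rightarrow> ('a \<Rightarrow> 'a) \<Rightarrow> bool" where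
  "positive_self_adjoint_op D A \<longleftrightarrow>
     self_adjoint_op D A \<and> (\<forall>x\<in>D. 0 \<le> Re (cinner (A x) x))"


section \<open>Semigroups, mild solutions and null controllability\<close>

text \<open>Only the values of a semigroup at nonnegative times are relevant.\<close>

definition c0_semigroup :: "(real \<Rightarrow> 'a::complex_hilbert \<Rightarrow> 'a) \<Rightarrow> bool" where
  "c0_semigroup S \<longleftrightarrow>
     (\<forall>t\<ge>0. bounded_linear (S t) \<and> (\<forall>c x. S t (c *\<^sub>C x) = c *\<^sub>C S t x)) \<and>
     S 0 = id \<and>
     (\<forall>s\<ge>0. \<forall>t\<ge>0. S (s + t) = S s \<circ> S t) \<and>
     (\<forall>x. ((\<lambda>t. S t x) \<longlongrightarrow> x) (at_right 0))"

definition generates :: "'a::complex_hilbert set \<Rightarrow> ('a \<Rightarrow> 'a) \<Rightarrow> (real \<Rightarrow> 'a \<Rightarrow> 'a) \<Rightarrow> bool" where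
  "generates D A S \<longleftrightarrow>
     D = {x. \<exists>z. ((\<lambda>h. (S h x - x) /\<^sub>R h) \<longlongrightarrow> z) (at_right 0)} \<and>
     (\<forall>x\<in>D. ((\<lambda>h. (S h x - x) /\<^sub>R h) \<longlongrightarrow> A x) (at_right 0))"

text \<open>
  \<open>second_countable_topology\<close> (separability) is required by the library's Bochner integral;
  it is automatic for a space with a countable Hilbert basis.
\<close>

definition L2_control ::
    "real \<Rightarrow> (real \<Rightarrow> 'u::{complex_hilbert, second_countable_topology}) \<Rightarrow> bool" where
  "L2_control T u \<longleftrightarrow>
     u \<in> borel_measurable (lebesgue_on {0<..<T}) \<and>
     integrable (lebesgue_on {0<..<T}) (\<lambda>t. (norm (u t))\<^sup>2)"

text \<open>
  The semigroup generated by a given operator is unique at nonnegative times, so the mild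
  solution on \<open>[0,T]\<close> is unique as well.
\<close>

definition mild_solution ::
    "'h::{complex_hilbert, second_countable_topology} set \<Rightarrow> ('h \<Rightarrow> 'h) \<Rightarrow>
     ('u::{complex_hilbert, second_countable_topology} \<Rightarrow> 'h) \<Rightarrow> real \<Rightarrow>
     'h \<Rightarrow> (real \<Rightarrow> 'u) \<Rightarrow> (real \<Rightarrow> 'h) \<Rightarrow> bool" where
  "mild_solution D A B T y\<^sub>0 u y \<longleftrightarrow>
     (\<exists>S. c0_semigroup S \<and> generates D A S \<and>
       (\<forall>t\<in>{0..T}. y t = S t y\<^sub>0 + (\<integral>s. S (t - s) (B (u s)) \<partial>lebesgue_on {0<..<t})))"

definition null_controllable ::
    "'h::{complex_hilbert, second_countable_topology} set \<Rightarrow> ('h \<Rightarrow> 'h) \<Rightarrow>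
     ('u::{complex_hilbert, second_countable_topology} \<Rightarrow> 'h) \<Rightarrow> real \<Rightarrow> bool" where
  "null_controllable D A B T \<longleftrightarrow>
     (\<forall>y\<^sub>0. \<exists>u y. L2_control T u \<and> mild_solution D A B T y\<^sub>0 u y \<and> y T = 0)"


section \<open>The time threshold\<close>

definition resolvent_estimate ::
    "'h::complex_hilbert set \<Rightarrow> ('h \<Rightarrow> 'h) \<Rightarrow> ('u::complex_hilbert \<Rightarrow> 'h) \<Rightarrow> real \<Rightarrow> bool" where
  "resolvent_estimate D A B T \<longleftrightarrow>
     (\<exists>C>0. \<forall>y\<in>adj_dom D A. \<forall>\<mu>::complex. Re \<mu> > 0 \<longrightarrow>
        (norm y)\<^sup>2 \<le> C * exp (2 * T * Re \<mu>) *
          ((norm (adj D A y + \<mu> *\<^sub>C y))\<^sup>2 / (Re \<mu>)\<^sup>2 + (norm (adj UNIV B y))\<^sup>2 / Re \<mu>))"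

text \<open>In the extended reals the infimum of the empty set is \<open>\<infinity>\<close>.\<close>

definition T_star ::
    "'h::complex_hilbert set \<Rightarrow> ('h \<Rightarrow> 'h) \<Rightarrow> ('u::complex_hilbert \<Rightarrow> 'h) \<Rightarrow> ereal" where
  "T_star D A B = Inf (ereal ` {T. 0 < T \<and> resolvent_estimate D A B T})"


section \<open>The two-component system\<close>

definition comp_vec :: "'x::zero \<Rightarrow> nat \<Rightarrow> 'x \<times> 'x" where
  "comp_vec x i = (if i = 1 then (x, 0) else (0, x))"

definition control_op :: "real \<Rightarrow> real \<Rightarrow> 'x::complex_hilbert \<Rightarrow> 'x \<times> 'x" where
  "control_op b\<^sub>1 b\<^sub>2 u = (b\<^sub>1 *\<^sub>R u, b\<^sub>2 *\<^sub>R u)"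

end

theory Submission
  imports Defs
begin

text \<open>
  Both sides of the equivalence are governed by how fast the eigenvalue pairs condense. In the
  basis \<open>\<phi>\<^sub>k\<close> the system splits into independent \<open>2 \<times> 2\<close> systems: the \<open>k\<close>-th one has the
  eigenvalues \<open>l\<^sub>1 k < l\<^sub>2 k\<close> and one scalar control, which enters the two components with the
  factors \<open>b\<^sub>1\<close> and \<open>b\<^sub>2\<close>. If a factor vanishes, one component is out of reach: null
  controllability and the resolvent estimate fail for all times. Otherwise the difficulty of
  steering the \<open>k\<close>-th system is measured by its gap \<open>l\<^sub>2 k - l\<^sub>1 k\<close>, to be compared with the
  dissipation \<open>exp (- T * l\<^sub>1 k)\<close> gained in time \<open>T\<close>. The condition \<open>gap_bound T\<close> says that the
  gaps are at least of this order.

  The resolvent estimate at time \<open>T\<close> gives \<open>gap_bound T\<close> (\<open>gap_bound_if_resolvent_estimate\<close>):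
  test it with \<open>(b\<^sub>2 \<phi>\<^sub>k, - b\<^sub>1 \<phi>\<^sub>k)\<close>, which the observation annihilates, at the spectral parameter
  \<open>l\<^sub>1 k\<close>. Conversely \<open>gap_bound T\<close> gives the estimate at every later time
  (\<open>resolvent_estimate_if_gap_bound\<close>): a spectral parameter near both eigenvalues of a pair is
  still at distance half the gap from one of them, so that component is controlled by the
  resolvent and the other one by the observation; the delay absorbs powers of the parameter.

  Null controllability at time \<open>T\<close> gives \<open>gap_bound T\<close> (\<open>gap_bound_if_null_controllable\<close>): to
  move one component without disturbing the other, a control must separate \<open>exp (- l\<^sub>1 k * t)\<close>
  from \<open>exp (- l\<^sub>2 k * t)\<close>, whose distance is at most \<open>T\<close> times the gap; an initial state
  concentrated on modes with gaps that are too small cannot be steered by any square integrable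
  control. Conversely, \<open>gap_bound T\<^sub>0\<close> gives null controllability for every \<open>T > T\<^sub>0\<close>
  (\<open>null_controllable_if_gap_bound\<close>) with an explicit control
  \<open>s * (T - s) * v + (2 * s - T) * w\<close>, \<open>v, w \<in> X\<close>: the second profile is minus the derivative of the first, so its moment against
  \<open>exp (- l * (T - s))\<close> is \<open>l\<close> times that of the first, and the coefficients of \<open>v\<close> and \<open>w\<close>
  solve a linear interpolation problem at the nodes \<open>l\<^sub>1 k\<close>, \<open>l\<^sub>2 k\<close>.

  Mild solutions refer to some semigroup generated by \<open>A\<close>. Existence is shown by exponentiating
  the eigenvalues (\<open>generates_semigroup\<close>), and \<open>coeff_generated_semigroup\<close> shows that every
  generated semigroup acts on the coefficients in this way.
\<close>

text \<open>
  Convergence of Cauchy series and Bochner integration are stated for the class \<open>banach\<close>, whose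
  axioms are those of a complete normed space.
\<close>

instance complex_hilbert \<subseteq> banach ..

section \<open>Complex inner products\<close>

lemma cinner_add_right: "cinner x (y + z) = cinner x y + cinner x z"
  using cinner_commute[of x "y + z"] cinner_commute[of x y] cinner_commute[of x z]
  by (simp add: cinner_add_left)

lemma cinner_scaleC_right: "cinner x (a *\<^sub>C y) = cnj a * cinner x y"
  using cinner_commute[of x "a *\<^sub>C y"] cinner_commute[of x y]
  by (simp add: cinner_scaleC_left)

lemma cinner_scaleR_left: "cinner (r *\<^sub>R x) y = of_real r * cinner x y"
  by (metis cinner_scaleC_left scaleC_of_real)

lemma cinner_scaleR_right: "cinner x (r *\<^sub>R y) = of_real r * cinner x y"
  by (metis cinner_scaleC_right scaleC_of_real complex_cnj_complex_of_real)

lemma cinner_eq_inner: "cinner x y = of_real (inner x y) + \<i> * of_real (inner x (\<i> *\<^sub>C y))"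
  by (rule complex_eqI) (simp_all add: Re_cinner[symmetric] cinner_scaleC_right)

lemma bounded_linear_cinner_left: "bounded_linear (\<lambda>x. cinner x y)"
  unfolding cinner_eq_inner
  by (intro bounded_linear_add bounded_linear_const_mult bounded_linear_of_real
        bounded_linear_compose[OF bounded_linear_of_real] bounded_linear_inner_left)

lemma bounded_linear_cinner_right: "bounded_linear (\<lambda>y. cinner x y)"
  unfolding cinner_commute[of x]
  by (rule bounded_linear_compose[OF bounded_linear_cnj bounded_linear_cinner_left])

lemmas cinner_diff_left = linear_diff[OF bounded_linear.linear[OF bounded_linear_cinner_left]]
lemmas cinner_minus_left = linear_neg[OF bounded_linear.linear[OF bounded_linear_cinner_left]]
lemmas cinner_sum_left = linear_sum[OF bounded_linear.linear[OF bounded_linear_cinner_left]]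
lemmas cinner_zero_left = linear_0[OF bounded_linear.linear[OF bounded_linear_cinner_left]]
lemmas cinner_diff_right = linear_diff[OF bounded_linear.linear[OF bounded_linear_cinner_right]]
lemmas cinner_minus_right = linear_neg[OF bounded_linear.linear[OF bounded_linear_cinner_right]]
lemmas cinner_zero_right = linear_0[OF bounded_linear.linear[OF bounded_linear_cinner_right]]
lemmas tendsto_cinner_left = bounded_linear.tendsto[OF bounded_linear_cinner_left]
lemmas continuous_on_cinner_left = bounded_linear.continuous_on[OF bounded_linear_cinner_left]

lemma cinner_self: "cinner x x = of_real ((norm x)\<^sup>2)"
proof (rule complex_eqI)
  show "Re (cinner x x) = Re (of_real ((norm x)\<^sup>2))"
    by (simp add: Re_cinner power2_norm_eq_inner)
  show "Im (cinner x x) = Im (of_real ((norm x)\<^sup>2))"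
    using arg_cong[OF cinner_commute[of x x], of Im] by simp
qed

text \<open>
  The kernel of \<open>\<lambda>x. cinner x w\<close> is closed; if it contains a dense set, then it contains \<open>w\<close>.
\<close>

lemma orthogonal_to_dense:
  fixes w :: "'a::complex_inner"
  assumes "closure D = UNIV" and "\<And>x. x \<in> D \<Longrightarrow> cinner x w = 0"
  shows "w = 0"
proof -
  have "closed {x. cinner x w = 0}"
    by (intro closed_Collect_eq continuous_on_cinner_left continuous_intros)
  then have "closure D \<subseteq> {x. cinner x w = 0}"
    using assms(2) by (intro closure_minimal) auto
  then have "cinner w w = 0"
    using assms(1) by auto
  then show ?thesis
    by (simp add: cinner_self)
qed

lemma adj_eqI:
  assumes "closure D = UNIV" and "\<And>x. x \<in> D \<Longrightarrow> cinner (A x) y = cinner x z"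
  shows "adj D A y = z"
  unfolding adj_def
proof (rule the_equality)
  show "\<forall>x\<in>D. cinner (A x) y = cinner x z"
    using assms(2) by blast
  fix z' assume "\<forall>x\<in>D. cinner (A x) y = cinner x z'"
  then have "z' - z = 0"
    using assms(2) by (intro orthogonal_to_dense[OF assms(1)]) (simp add: cinner_diff_right)
  then show "z' = z" by simp
qed

section \<open>Orthonormal bases\<close>

locale orthonormal_basis =
  fixes \<psi> :: "nat \<Rightarrow> 'a::complex_hilbert"
  assumes orthonormal: "cinner (\<psi> j) (\<psi> k) = (if j = k then 1 else 0)"
    and complete: "(\<And>k. cinner x (\<psi> k) = 0) \<Longrightarrow> x = 0"
begin

abbreviation coeff :: "'a \<Rightarrow> nat \<Rightarrow> complex" where
  "coeff x k \<equiv> cinner x (\<psi> k)"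

lemma coeff_basis [simp]: "coeff (\<psi> j) k = (if j = k then 1 else 0)"
  by (rule orthonormal)

lemma norm_basis [simp]: "norm (\<psi> k) = 1"
  using cinner_self[of "\<psi> k"] by (simp add: power2_eq_1_iff del: of_real_power)
    (smt (verit) norm_ge_zero of_real_eq_1_iff power2_eq_1_iff)

lemma coeff_eqI: "(\<And>k. coeff x k = coeff y k) \<Longrightarrow> x = y"
  using complete[of "x - y"] by (simp add: cinner_diff_left)

lemma coeff_sum:
  "finite F \<Longrightarrow> coeff (\<Sum>k\<in>F. a k *\<^sub>C \<psi> k) j = (if j \<in> F then a j else 0)"
  by (simp add: cinner_sum_left cinner_scaleC_left if_distrib[where f="\<lambda>x. _ * x"] sum.delta' cong: if_cong)

lemma inner_sum_basis:
  assumes "finite F"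
  shows "inner x (\<Sum>k\<in>F. a k *\<^sub>C \<psi> k) = (\<Sum>k\<in>F. Re (cnj (a k) * coeff x k))"
  by (subst inner_sum_right) (simp only: Re_cinner[symmetric] cinner_scaleC_right)

lemma norm_sum_basis:
  assumes "finite F"
  shows "(norm (\<Sum>k\<in>F. a k *\<^sub>C \<psi> k))\<^sup>2 = (\<Sum>k\<in>F. (cmod (a k))\<^sup>2)"
  unfolding power2_norm_eq_inner[of "\<Sum>k\<in>F. a k *\<^sub>C \<psi> k"] inner_sum_basis[OF assms]
  by (intro sum.cong refl)
    (simp add: coeff_sum[OF assms] cmod_power2 power2_eq_square[of "Re _"]
      power2_eq_square[of "Im _"])

lemma bessel:
  assumes "finite F"
  shows "(\<Sum>k\<in>F. (cmod (coeff x k))\<^sup>2) \<le> (norm x)\<^sup>2"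
proof -
  let ?s = "\<Sum>k\<in>F. coeff x k *\<^sub>C \<psi> k"
  \<comment> \<open>\<open>?s\<close> is the orthogonal projection of \<open>x\<close> to the span of the \<open>\<psi> k\<close>, \<open>k \<in> F\<close>.\<close>
  have "inner x ?s = (norm ?s)\<^sup>2"
    unfolding inner_sum_basis[OF assms] norm_sum_basis[OF assms]
    by (simp add: cmod_power2 power2_eq_square[of "Re _"] power2_eq_square[of "Im _"])
  then have "(norm (x - ?s))\<^sup>2 = (norm x)\<^sup>2 - (norm ?s)\<^sup>2"
    by (simp add: power2_norm_eq_inner inner_diff_left inner_diff_right inner_commute)
  then have "(norm ?s)\<^sup>2 \<le> (norm x)\<^sup>2"
    by (smt (verit) zero_le_power2)
  then show ?thesis
    by (simp add: norm_sum_basis[OF assms])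
qed

lemma cmod_coeff_le: "cmod (coeff x k) \<le> norm x"
  using bessel[of "{k}" x] by (simp add: power2_le_iff_abs_le)

lemma summable_coeff: "summable (\<lambda>k. (cmod (coeff x k))\<^sup>2)"
  by (rule summableI_nonneg_bounded[where x="(norm x)\<^sup>2"]) (auto intro: bessel)

text \<open>Riesz--Fischer: partial sums are Cauchy by Pythagoras.\<close>

lemma summable_basis:
  assumes "summable (\<lambda>k. (cmod (a k))\<^sup>2)"
  shows "summable (\<lambda>k. a k *\<^sub>C \<psi> k)"
  unfolding summable_Cauchy
proof (intro allI impI)
  fix e :: real assume "e > 0"
  then have "e\<^sup>2 > 0" by simp
  then obtain N where N: "\<forall>m\<ge>N. \<forall>n. norm (\<Sum>k=m..<n. (cmod (a k))\<^sup>2) < e\<^sup>2"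
    using assms[unfolded summable_Cauchy] by blast
  show "\<exists>N. \<forall>m\<ge>N. \<forall>n. norm (\<Sum>k=m..<n. a k *\<^sub>C \<psi> k) < e"
  proof (intro exI[of _ N] allI impI)
    fix m n assume "m \<ge> N"
    then have "(norm (\<Sum>k=m..<n. a k *\<^sub>C \<psi> k))\<^sup>2 < e\<^sup>2"
      using N by (auto simp: norm_sum_basis sum_nonneg)
    then show "norm (\<Sum>k=m..<n. a k *\<^sub>C \<psi> k) < e"
      using \<open>e > 0\<close> by (simp add: power_less_imp_less_base)
  qed
qed

lemma coeff_suminf:
  assumes "summable (\<lambda>k. (cmod (a k))\<^sup>2)"
  shows "coeff (\<Sum>k. a k *\<^sub>C \<psi> k) j = a j"
proof -
  have "coeff (\<Sum>k. a k *\<^sub>C \<psi> k) j = (\<Sum>k. coeff (a k *\<^sub>C \<psi> k) j)"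
    by (rule bounded_linear.suminf[OF bounded_linear_cinner_left summable_basis[OF assms]])
  also have "\<dots> = (\<Sum>k\<in>{j}. coeff (a k *\<^sub>C \<psi> k) j)"
    by (rule suminf_finite) (auto simp: cinner_scaleC_left)
  finally show ?thesis by (simp add: cinner_scaleC_left)
qed

text \<open>
  The series converges by Riesz--Fischer, and its sum has the same coefficients as \<open>x\<close>.
\<close>

lemma expansion: "(\<lambda>k. coeff x k *\<^sub>C \<psi> k) sums x"
proof -
  have "(\<Sum>k. coeff x k *\<^sub>C \<psi> k) = x"
    by (rule coeff_eqI) (rule coeff_suminf[OF summable_coeff])
  then show ?thesis
    using summable_sums[OF summable_basis[OF summable_coeff[of x]]] by simp
qed

lemma parseval: "(\<lambda>k. (cmod (coeff x k))\<^sup>2) sums (norm x)\<^sup>2"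
proof -
  have "(\<lambda>n. (norm (\<Sum>k<n. coeff x k *\<^sub>C \<psi> k))\<^sup>2) \<longlonglongrightarrow> (norm x)\<^sup>2"
    using expansion[of x] unfolding sums_def by (intro tendsto_intros)
  then show ?thesis
    by (simp add: sums_def norm_sum_basis)
qed

lemma parseval_cinner: "(\<lambda>k. coeff x k * cnj (coeff y k)) sums cinner x y"
proof -
  have "(\<lambda>k. cinner (coeff x k *\<^sub>C \<psi> k) y) sums cinner x y"
    by (rule bounded_linear.sums[OF bounded_linear_cinner_left expansion])
  then show ?thesis
    by (simp add: cinner_scaleC_left cinner_commute[of "\<psi> _" y])
qed

text \<open>
  Functions of a diagonal operator are multipliers. Symbols bounded by 1 are enough for
  contraction semigroups and their difference quotients.
\<close>

definition multiplier :: "(nat \<Rightarrow> real) \<Rightarrow> 'a \<Rightarrow> 'a" where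
  "multiplier m x = (\<Sum>k. (of_real (m k) * coeff x k) *\<^sub>C \<psi> k)"

lemma coeff_multiplier:
  assumes "\<And>k. \<bar>m k\<bar> \<le> 1"
  shows "coeff (multiplier m x) k = of_real (m k) * coeff x k"
  unfolding multiplier_def
proof (rule coeff_suminf, rule summable_comparison_test'[OF summable_coeff[of x]])
  fix n :: nat
  have "(m n)\<^sup>2 \<le> 1"
    using assms[of n] by (simp add: abs_square_le_1)
  then show "norm ((cmod (of_real (m n) * coeff x n))\<^sup>2) \<le> (cmod (coeff x n))\<^sup>2"
    by (simp add: norm_mult power_mult_distrib mult_left_le_one_le)
qed

lemma norm_multiplier_le:
  assumes "\<And>k. \<bar>m k\<bar> \<le> 1"
  shows "norm (multiplier m x) \<le> norm x"
proof -
  have "(norm (multiplier m x))\<^sup>2 \<le> (norm x)\<^sup>2"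
  proof (rule sums_le[OF _ parseval parseval])
    fix k
    have "(m k)\<^sup>2 \<le> 1"
      using assms[of k] by (simp add: abs_square_le_1)
    then show "(cmod (coeff (multiplier m x) k))\<^sup>2 \<le> (cmod (coeff x k))\<^sup>2"
      by (simp add: coeff_multiplier[OF assms] norm_mult power_mult_distrib mult_left_le_one_le)
  qed
  then show ?thesis
    by (simp add: power2_le_iff_abs_le)
qed

lemma multiplier_scaleC:
  assumes "\<And>k. \<bar>m k\<bar> \<le> 1"
  shows "multiplier m (a *\<^sub>C x) = a *\<^sub>C multiplier m x"
  by (rule coeff_eqI) (simp add: coeff_multiplier[OF assms] cinner_scaleC_left)

lemma bounded_linear_multiplier:
  assumes "\<And>k. \<bar>m k\<bar> \<le> 1"
  shows "bounded_linear (multiplier m)"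
proof (rule bounded_linear_intro[of _ 1])
  show "multiplier m (x + y) = multiplier m x + multiplier m y" for x y
    by (rule coeff_eqI) (simp add: coeff_multiplier[OF assms] cinner_add_left algebra_simps)
  show "multiplier m (r *\<^sub>R x) = r *\<^sub>R multiplier m x" for r x
    using multiplier_scaleC[OF assms, where a="of_real r" and x=x] by (simp add: scaleC_of_real)
  show "norm (multiplier m x) \<le> norm x * 1" for x
    using norm_multiplier_le[OF assms] by simp
qed

text \<open>
  Pointwise convergence of uniformly bounded symbols gives strong convergence, by dominated
  convergence for series applied to Parseval's identity. Strong continuity of the semigroup and
  differentiability on the domain are both instances.
\<close>

lemma tendsto_multiplier:
  assumes bound: "\<forall>\<^sub>F i in F. \<forall>k. \<bar>m i k\<bar> \<le> 1" and bound0: "\<And>k. \<bar>m0 k\<bar> \<le> 1"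
    and lim: "\<And>k. ((\<lambda>i. m i k) \<longlongrightarrow> m0 k) F"
  shows "((\<lambda>i. multiplier (m i) x) \<longlongrightarrow> multiplier m0 x) F"
proof (cases "F = bot")
  case False
  let ?a = "\<lambda>k i. (m i k - m0 k)\<^sup>2 * (cmod (coeff x k))\<^sup>2"
  have "((\<lambda>i. \<Sum>k. ?a k i) \<longlongrightarrow> (\<Sum>k. 0)) F"
  proof (rule tannerys_theorem[THEN conjunct2, THEN conjunct2])
    show "((\<lambda>i. ?a k i) \<longlongrightarrow> 0) F" for k
      using lim[of k] by (auto intro!: tendsto_eq_intros)
    have "\<forall>\<^sub>F i in F. \<forall>k. norm (?a k i) \<le> 4 * (cmod (coeff x k))\<^sup>2"
      using bound
    proof eventually_elim
      case (elim i)
      have "(m i k - m0 k)\<^sup>2 \<le> 2\<^sup>2" for k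
        using elim[rule_format, of k] bound0[of k] by (intro power2_le_iff_abs_le[THEN iffD2]) auto
      then show ?case by (auto intro!: mult_right_mono)
    qed
    then show "\<forall>\<^sub>F (k, i) in at_top \<times>\<^sub>F F. norm (?a k i) \<le> 4 * (cmod (coeff x k))\<^sup>2"
      unfolding eventually_prod_filter
      by (intro exI[of _ "\<lambda>_. True"] exI[of _ "\<lambda>i. \<forall>k. norm (?a k i) \<le> 4 * (cmod (coeff x k))\<^sup>2"])
        auto
    show "summable (\<lambda>k. 4 * (cmod (coeff x k))\<^sup>2)"
      by (intro summable_mult summable_coeff)
  qed (use False in simp)
  moreover have "\<forall>\<^sub>F i in F. (\<Sum>k. ?a k i) = (norm (multiplier (m i) x - multiplier m0 x))\<^sup>2"
    using bound
  proof eventually_elim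
    case (elim i)
    have "coeff (multiplier (m i) x - multiplier m0 x) k = of_real (m i k - m0 k) * coeff x k" for k
      using elim bound0 by (simp add: cinner_diff_left coeff_multiplier algebra_simps)
    then show ?case
      using sums_unique[OF parseval[of "multiplier (m i) x - multiplier m0 x"]]
      by (simp add: norm_mult power_mult_distrib del: of_real_diff)
  qed
  ultimately have "((\<lambda>i. (norm (multiplier (m i) x - multiplier m0 x))\<^sup>2) \<longlongrightarrow> (\<Sum>k. 0)) F"
    by (rule Lim_transform_eventually)
  then have "((\<lambda>i. sqrt ((norm (multiplier (m i) x - multiplier m0 x))\<^sup>2)) \<longlongrightarrow> sqrt (\<Sum>k. 0)) F"
    by (rule tendsto_real_sqrt)
  then show ?thesis
    by (simp add: tendsto_norm_zero_iff LIM_zero_iff)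
qed simp

end

section \<open>Diagonal operators\<close>

lemma exp_difference_quotient: "((\<lambda>h. (exp (c * h) - 1) / h) \<longlongrightarrow> c) (at_right (0::real))"
proof -
  have "((\<lambda>h. exp (c * h)) has_real_derivative c) (at 0)"
    by (auto intro!: derivative_eq_intros)
  then have "((\<lambda>h. (exp (c * h) - 1) / h) \<longlongrightarrow> c) (at 0)"
    by (simp add: has_field_derivative_iff)
  then show ?thesis
    by (rule Lim_at_imp_Lim_at_within)
qed

lemma norm_power_minus_one_le:
  fixes z :: complex
  shows "norm (z ^ n - 1) \<le> (1 + norm (z - 1)) ^ n - 1"
proof (induction n)
  case (Suc n)
  have z: "norm z \<le> 1 + norm (z - 1)"
    using norm_triangle_ineq[of 1 "z - 1"] by simp
  have "z ^ Suc n - 1 = z * (z ^ n - 1) + (z - 1)"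
    by (simp add: algebra_simps)
  then have "norm (z ^ Suc n - 1) \<le> norm z * norm (z ^ n - 1) + norm (z - 1)"
    by (metis norm_mult norm_triangle_ineq)
  also have "\<dots> \<le> (1 + norm (z - 1)) * ((1 + norm (z - 1)) ^ n - 1) + norm (z - 1)"
    using Suc z by (intro add_mono mult_mono) auto
  finally show ?case by (simp add: algebra_simps)
qed simp

text \<open>
  After division by \<open>exp (c * t)\<close> the right derivative at 0 vanishes. For small steps
  \<open>h = t / n\<close> the value at \<open>h\<close> is within \<open>e * h\<close> of 1, so its \<open>n\<close>-th power, the value at \<open>t\<close>,
  is within \<open>exp (t * e) - 1\<close> of 1.
\<close>

lemma exponential_if_multiplicative:
  fixes \<theta> :: "real \<Rightarrow> complex"
  assumes mult: "\<And>s t. s \<ge> 0 \<Longrightarrow> t \<ge> 0 \<Longrightarrow> \<theta> (s + t) = \<theta> s * \<theta> t" and one: "\<theta> 0 = 1"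
    and lim: "((\<lambda>h. (\<theta> h - 1) / of_real h) \<longlongrightarrow> of_real c) (at_right 0)"
    and t: "t \<ge> 0"
  shows "\<theta> t = of_real (exp (c * t))"
proof (cases "t = 0")
  case False
  with t have t: "t > 0" by simp
  define g where "g s = of_real (exp (- c * s)) * \<theta> s" for s
  have g_mult: "g (real n * s) = g s ^ n" if "s \<ge> 0" for n s
  proof (induction n)
    case (Suc n)
    have "g (real (Suc n) * s) = g (real n * s) * g s"
      using mult[of "real n * s" s] that
      by (simp add: g_def algebra_simps exp_add[symmetric] flip: of_real_mult)
    with Suc show ?case by simp
  qed (simp add: g_def one)
  have "((\<lambda>h. of_real (exp (- c * h)) * ((\<theta> h - 1) / of_real h)
      + of_real ((exp (- c * h) - 1) / h)) \<longlongrightarrow> of_real (exp (- c * 0)) * of_real c + of_real (- c))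
      (at_right 0)"
    by (intro tendsto_intros lim exp_difference_quotient)
  then have g_lim: "((\<lambda>h. (g h - 1) / of_real h) \<longlongrightarrow> 0) (at_right 0)"
    by (simp add: g_def right_diff_distrib diff_divide_distrib)
  have le: "norm (g t - 1) \<le> exp (t * e) - 1" if "e > 0" for e
  proof -
    from tendstoD[OF g_lim \<open>e > 0\<close>] obtain d where "d > 0"
      and d: "\<And>h. 0 < h \<Longrightarrow> h < d \<Longrightarrow> norm ((g h - 1) / of_real h) < e"
      by (auto simp: eventually_at_right_field)
    obtain n where n: "t / d < real n"
      using reals_Archimedean2 by blast
    with t \<open>d > 0\<close> have "n > 0"
      by (metis divide_pos_pos gr0I not_less_iff_gr_or_eq of_nat_0)
    then have h: "0 < t / n" "t / n < d"
      using t n \<open>d > 0\<close> by (simp_all add: field_simps)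
    have "norm (g (t / n) - 1) \<le> t * e / n"
      using d[OF h] h t \<open>n > 0\<close>
      by (simp add: norm_divide pos_divide_less_eq del: of_real_divide) (simp add: field_simps)
    then have "(1 + norm (g (t / n) - 1)) ^ n \<le> exp (t * e / n) ^ n"
      by (intro power_mono) (use exp_ge_add_one_self[of "t * e / n"] in linarith, simp)
    also have "\<dots> = exp (t * e)"
      using \<open>n > 0\<close> by (simp flip: exp_of_nat_mult)
    finally show ?thesis
      using norm_power_minus_one_le[of "g (t / n)" n] g_mult[of "t / n" n] h \<open>n > 0\<close> by simp
  qed
  have "((\<lambda>e. exp (t * e) - 1) \<longlongrightarrow> exp (t * 0) - 1) (at_right 0)"
    by (intro tendsto_intros)
  moreover have "\<forall>\<^sub>F e in at_right 0. norm (g t - 1) \<le> exp (t * e) - 1"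
    using le by (simp add: eventually_at_right_less eventually_mono[OF eventually_at_right_less])
  ultimately have "norm (g t - 1) \<le> exp (t * 0) - 1"
    by (rule tendsto_lowerbound) simp
  then have "of_real (exp (c * t)) * g t = of_real (exp (c * t))"
    by simp
  then show ?thesis
    by (simp add: g_def mult.assoc[symmetric] exp_add[symmetric] flip: of_real_mult)
qed (simp add: one)

text \<open>
  Simplicity of the eigenvalues makes every operator that commutes with \<open>A\<close> diagonal; this is
  used to identify all semigroups generated by \<open>A\<close>.
\<close>

locale diagonal_operator = orthonormal_basis \<psi>
  for \<psi> :: "nat \<Rightarrow> 'h::complex_hilbert" +
  fixes D :: "'h set" and A :: "'h \<Rightarrow> 'h" and l :: "nat \<Rightarrow> real"
  assumes positive_self_adjoint: "positive_self_adjoint_op D (\<lambda>y. - A y)"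
    and basis_in_domain: "\<psi> n \<in> D"
    and eigenvector: "A (\<psi> n) = - (l n *\<^sub>R \<psi> n)"
    and simple: "inj l"
begin

lemma dense: "closure D = UNIV"
  using positive_self_adjoint
  by (simp add: positive_self_adjoint_op_def self_adjoint_op_def densely_defined_op_def)

lemma adj_dom_A: "adj_dom D A = D"
proof -
  have "adj_dom D A = adj_dom D (\<lambda>y. - A y)"
    unfolding adj_dom_def
    by (auto simp: cinner_minus_left) (metis cinner_minus_right minus_minus)+
  then show ?thesis
    using positive_self_adjoint by (simp add: positive_self_adjoint_op_def self_adjoint_op_def)
qed

lemma symmetric:
  assumes "x \<in> D" "y \<in> D"
  shows "cinner (A x) y = cinner x (A y)"
proof -
  have "y \<in> adj_dom D (\<lambda>y. - A y)" and adj: "adj D (\<lambda>y. - A y) y = - A y"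
    using positive_self_adjoint assms(2)
    by (auto simp: positive_self_adjoint_op_def self_adjoint_op_def)
  then obtain z where z: "\<And>x. x \<in> D \<Longrightarrow> cinner (- A x) y = cinner x z"
    by (auto simp: adj_dom_def)
  then have "z = - A y"
    using adj_eqI[OF dense, of "\<lambda>y. - A y" y z] adj by simp
  then show ?thesis
    using z[OF assms(1)] by (simp add: cinner_minus_left cinner_minus_right)
qed

lemma adj_A: "y \<in> D \<Longrightarrow> adj D A y = A y"
  by (intro adj_eqI dense symmetric)

lemma coeff_A: "x \<in> D \<Longrightarrow> coeff (A x) n = - of_real (l n) * coeff x n"
  using symmetric[OF _ basis_in_domain, of x n]
  by (simp add: eigenvector cinner_minus_right cinner_scaleR_right)

text \<open>
  The domain is maximal among those compatible with the eigenvalues. By Parseval, \<open>z\<close> represents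
  the functional \<open>y \<mapsto> cinner (A y) x\<close>, so \<open>x\<close> is in the domain of the adjoint, which is that of
  \<open>A\<close>.
\<close>

lemma in_domainI:
  assumes "\<And>n. coeff z n = - of_real (l n) * coeff x n"
  shows "x \<in> D \<and> A x = z"
proof
  have "cinner (A y) x = cinner y z" if "y \<in> D" for y
    using sums_unique2[OF parseval_cinner[of "A y" x] ] parseval_cinner[of y z]
    by (simp add: assms coeff_A[OF that] algebra_simps)
  then have "x \<in> adj_dom D A"
    by (auto simp: adj_dom_def)
  then show x: "x \<in> D"
    by (simp add: adj_dom_A)
  show "A x = z"
    by (rule coeff_eqI) (simp add: coeff_A[OF x] assms)
qed

lemma eigenvalue_nonneg: "l n \<ge> 0"
proof -
  have "0 \<le> Re (cinner (- A (\<psi> n)) (\<psi> n))"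
    using positive_self_adjoint basis_in_domain by (auto simp: positive_self_adjoint_op_def)
  then show ?thesis
    by (simp add: eigenvector cinner_scaleR_left)
qed

definition exp_semigroup :: "real \<Rightarrow> 'h \<Rightarrow> 'h" where
  "exp_semigroup t = multiplier (\<lambda>n. exp (- l n * t))"

lemma exp_bound: "t \<ge> 0 \<Longrightarrow> \<bar>exp (- l n * t)\<bar> \<le> 1"
  using eigenvalue_nonneg[of n] by simp

lemma coeff_semigroup: "t \<ge> 0 \<Longrightarrow> coeff (exp_semigroup t x) n = of_real (exp (- l n * t)) * coeff x n"
  unfolding exp_semigroup_def by (rule coeff_multiplier[OF exp_bound])

lemma coeff_difference_quotient:
  assumes "h > 0"
  shows "coeff ((exp_semigroup h x - x) /\<^sub>R h) n = of_real ((exp (- l n * h) - 1) / h) * coeff x n"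
proof -
  have "coeff ((exp_semigroup h x - x) /\<^sub>R h) n = of_real (inverse h) * (of_real (exp (- l n * h)) - 1) * coeff x n"
    unfolding cinner_scaleR_left cinner_diff_left
    using assms by (simp only: coeff_semigroup less_imp_le left_diff_distrib mult_1_left mult.assoc)
  then show ?thesis
    by (simp add: divide_inverse mult.commute)
qed

lemma continuous_on_semigroup: "continuous_on {0..} (\<lambda>t. exp_semigroup t x)"
  unfolding continuous_on_def
proof
  fix t :: real assume t: "t \<in> {0..}"
  show "((\<lambda>t. exp_semigroup t x) \<longlongrightarrow> exp_semigroup t x) (at t within {0..})"
    unfolding exp_semigroup_def
  proof (rule tendsto_multiplier)
    show "\<forall>\<^sub>F t in at t within {0..}. \<forall>k. \<bar>exp (- l k * t)\<bar> \<le> 1"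
      using exp_bound by (auto simp: eventually_at_filter)
    show "((\<lambda>t. exp (- l k * t)) \<longlongrightarrow> exp (- l k * t)) (at t within {0..})" for k
      by (intro tendsto_intros)
  qed (use t exp_bound in auto)
qed

lemma c0_semigroup: "c0_semigroup exp_semigroup"
  unfolding c0_semigroup_def
proof (intro conjI allI impI)
  show "bounded_linear (exp_semigroup t)" if "t \<ge> 0" for t
    unfolding exp_semigroup_def by (rule bounded_linear_multiplier[OF exp_bound[OF that]])
  show "exp_semigroup t (c *\<^sub>C x) = c *\<^sub>C exp_semigroup t x" if "t \<ge> 0" for t c x
    unfolding exp_semigroup_def by (rule multiplier_scaleC[OF exp_bound[OF that]])
  show id: "exp_semigroup 0 = id"
    by (rule ext, rule coeff_eqI) (simp add: coeff_semigroup)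
  show "exp_semigroup (s + t) = exp_semigroup s \<circ> exp_semigroup t" if "s \<ge> 0" "t \<ge> 0" for s t
    by (rule ext, rule coeff_eqI) (use that in \<open>simp add: coeff_semigroup algebra_simps exp_diff exp_minus exp_add field_simps\<close>)
  show "((\<lambda>t. exp_semigroup t x) \<longlongrightarrow> x) (at_right 0)" for x
  proof -
    have "((\<lambda>t. exp_semigroup t x) \<longlongrightarrow> exp_semigroup 0 x) (at 0 within {0..})"
      using continuous_on_semigroup by (auto simp: continuous_on_def)
    then have "((\<lambda>t. exp_semigroup t x) \<longlongrightarrow> exp_semigroup 0 x) (at_right 0)"
      by (rule tendsto_within_subset) auto
    then show ?thesis by (simp add: id)
  qed
qed

text \<open>
  On the domain, the difference quotient of the semigroup is a multiplier applied to \<open>A x\<close>, with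
  a symbol between 0 and 1 that tends to 1. Conversely, a limit of difference quotients has the
  coefficients that \<open>in_domainI\<close> asks for.
\<close>

lemma generates_semigroup: "generates D A exp_semigroup"
proof -
  have lim: "((\<lambda>h. (exp_semigroup h x - x) /\<^sub>R h) \<longlongrightarrow> A x) (at_right 0)" if x: "x \<in> D" for x
  proof -
    define g where "g h n = (if l n * h = 0 then 1 else (1 - exp (- l n * h)) / (l n * h))" for h n
    have g_bound: "\<bar>g h n\<bar> \<le> 1" if "h \<ge> 0" for h n
      using exp_ge_add_one_self[of "- l n * h"] eigenvalue_nonneg[of n] that
      by (auto simp: g_def divide_simps)
    have g_lim: "((\<lambda>h. g h n) \<longlongrightarrow> 1) (at_right 0)" for n
    proof (cases "l n = 0")
      case False
      have "((\<lambda>h. (exp (- l n * h) - 1) / h / (- l n)) \<longlongrightarrow> - l n / - l n) (at_right 0)"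
        using False by (intro tendsto_divide tendsto_const exp_difference_quotient) auto
      moreover have "\<forall>\<^sub>F h in at_right 0. (exp (- l n * h) - 1) / h / (- l n) = g h n"
        using False by (auto simp: g_def eventually_at_filter field_simps)
      ultimately have "((\<lambda>h. g h n) \<longlongrightarrow> - l n / - l n) (at_right 0)"
        by (rule Lim_transform_eventually)
      then show ?thesis
        using False by simp
    qed (simp add: g_def)
    have "((\<lambda>h. multiplier (g h) (A x)) \<longlongrightarrow> multiplier (\<lambda>_. 1) (A x)) (at_right 0)"
      by (rule tendsto_multiplier) (use g_bound g_lim in \<open>auto simp: eventually_at_filter\<close>)
    then have lim: "((\<lambda>h. multiplier (g h) (A x)) \<longlongrightarrow> A x) (at_right 0)"
      by (rule back_subst[where P="\<lambda>z. (_ \<longlongrightarrow> z) _"])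
        (rule coeff_eqI, simp add: coeff_multiplier)
    have "multiplier (g h) (A x) = (exp_semigroup h x - x) /\<^sub>R h" if "h > 0" for h
    proof (rule coeff_eqI)
      fix n
      have "g h n * - l n = (exp (- l n * h) - 1) / h"
        using that by (simp add: g_def field_simps)
      then have "of_real (g h n) * (- of_real (l n)) = (of_real ((exp (- l n * h) - 1) / h) :: complex)"
        by (metis of_real_minus of_real_mult)
      moreover have "coeff (multiplier (g h) (A x)) n = of_real (g h n) * (- of_real (l n)) * coeff x n"
        using that g_bound by (simp add: coeff_multiplier coeff_A[OF x])
      ultimately show "coeff (multiplier (g h) (A x)) n = coeff ((exp_semigroup h x - x) /\<^sub>R h) n"
        using that by (simp only: coeff_difference_quotient)
    qed
    then have "\<forall>\<^sub>F h in at_right 0. multiplier (g h) (A x) = (exp_semigroup h x - x) /\<^sub>R h"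
      by (auto simp: eventually_at_filter)
    with lim show ?thesis
      by (rule Lim_transform_eventually)
  qed
  moreover have "x \<in> D" if z: "((\<lambda>h. (exp_semigroup h x - x) /\<^sub>R h) \<longlongrightarrow> z) (at_right 0)" for x z
  proof -
    have "coeff z n = - of_real (l n) * coeff x n" for n
    proof -
      have "((\<lambda>h. of_real ((exp (- l n * h) - 1) / h) * coeff x n) \<longlongrightarrow> of_real (- l n) * coeff x n)
          (at_right 0)"
        by (intro tendsto_intros exp_difference_quotient)
      moreover have "\<forall>\<^sub>F h in at_right 0. of_real ((exp (- l n * h) - 1) / h) * coeff x n
          = coeff ((exp_semigroup h x - x) /\<^sub>R h) n"
        unfolding eventually_at_filter
        by (intro always_eventually allI impI) (simp only: coeff_difference_quotient greaterThan_iff)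
      ultimately have "((\<lambda>h. coeff ((exp_semigroup h x - x) /\<^sub>R h) n) \<longlongrightarrow> of_real (- l n) * coeff x n)
          (at_right 0)"
        by (rule Lim_transform_eventually)
      then show ?thesis
        using tendsto_unique[OF _ tendsto_cinner_left[OF z]] by fastforce
    qed
    then show ?thesis
      using in_domainI by blast
  qed
  ultimately show ?thesis
    unfolding generates_def by blast
qed

text \<open>
  \<open>S t\<close> commutes with \<open>A\<close>, so it maps an eigenvector to an eigenvector for the same, simple,
  eigenvalue, that is, to a multiple \<open>\<theta> n t\<close> of itself. The scalar function \<open>\<theta> n\<close> is
  multiplicative with derivative \<open>- l n\<close> at 0, hence an exponential.
\<close>

lemma coeff_generated_semigroup:
  assumes S: "c0_semigroup S" and gen: "generates D A S" and t: "t \<ge> 0"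
  shows "coeff (S t x) n = of_real (exp (- l n * t)) * coeff x n"
proof -
  have bl: "bounded_linear (S t)" and scale: "S t (c *\<^sub>C x) = c *\<^sub>C S t x" if "t \<ge> 0" for t c x
    using S that by (auto simp: c0_semigroup_def)
  have S0: "S 0 x = x" and S_add: "s \<ge> 0 \<Longrightarrow> t \<ge> 0 \<Longrightarrow> S (s + t) x = S s (S t x)" for s t x
    using S by (auto simp: c0_semigroup_def)
  have lim: "((\<lambda>h. (S h (\<psi> n) - \<psi> n) /\<^sub>R h) \<longlongrightarrow> - (l n *\<^sub>R \<psi> n)) (at_right 0)" for n
    using gen[unfolded generates_def, THEN conjunct2, rule_format, OF basis_in_domain[of n]]
    by (simp only: eigenvector)
  define \<theta> where "\<theta> n t = coeff (S t (\<psi> n)) n" for n t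
  have eig: "S t (\<psi> n) = \<theta> n t *\<^sub>C \<psi> n" if t: "t \<ge> 0" for t n
  proof (rule coeff_eqI)
    fix m
    interpret St: bounded_linear "S t" by (rule bl[OF t])
    have "((\<lambda>h. S t ((S h (\<psi> n) - \<psi> n) /\<^sub>R h)) \<longlongrightarrow> S t (- (l n *\<^sub>R \<psi> n))) (at_right 0)"
      by (rule St.tendsto[OF lim])
    moreover have "\<forall>\<^sub>F h in at_right 0. S t ((S h (\<psi> n) - \<psi> n) /\<^sub>R h)
        = (S h (S t (\<psi> n)) - S t (\<psi> n)) /\<^sub>R h"
    proof -
      have "S t (S h x) = S h (S t x)" if "h > 0" for h x
        using S_add[of t h x] S_add[of h t x] t that by (simp add: add.commute)
      then show ?thesis
        by (auto simp: eventually_at_filter St.scaleR St.diff)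
    qed
    ultimately have "((\<lambda>h. (S h (S t (\<psi> n)) - S t (\<psi> n)) /\<^sub>R h) \<longlongrightarrow> S t (- (l n *\<^sub>R \<psi> n)))
        (at_right 0)"
      by (rule Lim_transform_eventually)
    then have L: "((\<lambda>h. (S h (S t (\<psi> n)) - S t (\<psi> n)) /\<^sub>R h) \<longlongrightarrow> - (l n *\<^sub>R S t (\<psi> n)))
        (at_right 0)"
      by (simp only: St.neg St.scaleR)
    then have dom: "S t (\<psi> n) \<in> D"
      unfolding gen[unfolded generates_def, THEN conjunct1] by blast
    have "A (S t (\<psi> n)) = - (l n *\<^sub>R S t (\<psi> n))"
      by (rule tendsto_unique[OF _ gen[unfolded generates_def, THEN conjunct2, rule_format, OF dom] L])
        simp
    then have "of_real (l m) * coeff (S t (\<psi> n)) m = of_real (l n) * coeff (S t (\<psi> n)) m"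
      using coeff_A[OF dom, of m] by (simp only: cinner_minus_left cinner_scaleR_left)
        (simp only: minus_mult_left[symmetric] neg_equal_iff_equal)
    then have "m = n \<or> coeff (S t (\<psi> n)) m = 0"
      using injD[OF simple, of m n] by auto
    then show "coeff (S t (\<psi> n)) m = coeff (\<theta> n t *\<^sub>C \<psi> n) m"
      by (auto simp: \<theta>_def cinner_scaleC_left)
  qed
  have \<theta>: "\<theta> n t = of_real (exp (- l n * t))" for n
  proof (rule exponential_if_multiplicative[OF _ _ _ t])
    show "\<theta> n (s + t) = \<theta> n s * \<theta> n t" if "s \<ge> 0" "t \<ge> 0" for s t
    proof -
      have "\<theta> n (s + t) *\<^sub>C \<psi> n = \<theta> n t *\<^sub>C \<theta> n s *\<^sub>C \<psi> n"
        using S_add[OF that, of "\<psi> n"] that by (simp only: eig scale add_nonneg_nonneg)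
      then have "coeff (\<theta> n (s + t) *\<^sub>C \<psi> n) n = coeff (\<theta> n t *\<^sub>C \<theta> n s *\<^sub>C \<psi> n) n"
        by (rule arg_cong)
      then show ?thesis
        by (simp add: cinner_scaleC_left)
    qed
    show "\<theta> n 0 = 1" by (simp add: \<theta>_def S0)
    have "((\<lambda>h. coeff ((S h (\<psi> n) - \<psi> n) /\<^sub>R h) n) \<longlongrightarrow> coeff (- (l n *\<^sub>R \<psi> n)) n) (at_right 0)"
      by (rule tendsto_cinner_left[OF lim])
    then show "((\<lambda>h. (\<theta> n h - 1) / of_real h) \<longlongrightarrow> of_real (- l n)) (at_right 0)"
      by (simp add: \<theta>_def cinner_scaleR_left cinner_diff_left cinner_minus_left divide_inverse
          mult.commute)
  qed
  have "bounded_linear (\<lambda>x. coeff (S t x) n)"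
    by (rule bounded_linear_compose[OF bounded_linear_cinner_left bl[OF t]])
  then have "(\<lambda>k. coeff (S t (coeff x k *\<^sub>C \<psi> k)) n) sums coeff (S t x) n"
    by (rule bounded_linear.sums[OF _ expansion])
  moreover have "(\<lambda>k. coeff (S t (coeff x k *\<^sub>C \<psi> k)) n) sums
      (\<Sum>k\<in>{n}. coeff (S t (coeff x k *\<^sub>C \<psi> k)) n)"
    by (rule sums_finite) (auto simp: scale[OF t] eig[OF t] cinner_scaleC_left)
  ultimately have "coeff (S t x) n = (\<Sum>k\<in>{n}. coeff (S t (coeff x k *\<^sub>C \<psi> k)) n)"
    by (rule sums_unique2)
  then show ?thesis
    by (simp add: scale[OF t] eig[OF t] cinner_scaleC_left \<theta>)
qed

end

section \<open>The two-component system\<close>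

lemma orthonormal_basis_if_hilbert_basis_on:
  assumes "hilbert_basis_on {1..} \<phi>"
  shows "orthonormal_basis (\<lambda>k. \<phi> (Suc k))"
proof
  show "cinner (\<phi> (Suc j)) (\<phi> (Suc k)) = (if j = k then 1 else 0)" for j k
    using assms by (auto simp: hilbert_basis_on_def)
  fix x assume x: "\<And>k. cinner x (\<phi> (Suc k)) = 0"
  have subspace: "complex_vector.subspace {y. cinner y x = 0}"
    by (auto simp: complex_vector.subspace_def cinner_zero_left cinner_add_left cinner_scaleC_left)
  have "cinner (\<phi> k) x = 0" if "k \<in> {1..}" for k
    using x[of "k - 1"] cinner_commute[of "\<phi> k" x] that by simp
  then have "complex_vector.span (\<phi> ` {1..}) \<subseteq> {y. cinner y x = 0}"
    by (intro complex_vector.span_minimal subspace) auto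
  moreover have "closure (complex_vector.span (\<phi> ` {1..})) = UNIV"
    using assms by (simp add: hilbert_basis_on_def)
  ultimately show "x = 0"
    by (intro orthogonal_to_dense) auto
qed

locale two_component_system = X: orthonormal_basis \<psi>
  for \<psi> :: "nat \<Rightarrow> 'x::{complex_hilbert, second_countable_topology}" +
  fixes D :: "('x \<times> 'x) set" and A :: "'x \<times> 'x \<Rightarrow> 'x \<times> 'x"
    and l\<^sub>1 l\<^sub>2 :: "nat \<Rightarrow> real" and b\<^sub>1 b\<^sub>2 :: real
  assumes positive_self_adjoint: "positive_self_adjoint_op D (\<lambda>y. - A y)"
    and basis_in_domain: "(\<psi> k, 0) \<in> D" "(0, \<psi> k) \<in> D"
    and eigenvector: "A (\<psi> k, 0) = - (l\<^sub>1 k *\<^sub>R (\<psi> k, 0))" "A (0, \<psi> k) = - (l\<^sub>2 k *\<^sub>R (0, \<psi> k))"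
    and interlaced: "l\<^sub>1 k < l\<^sub>2 k" "l\<^sub>2 k < l\<^sub>1 (Suc k)"
begin

text \<open>
  Listing the eigenvectors as \<open>\<phi>\<^sub>0 e\<^sub>1, \<phi>\<^sub>0 e\<^sub>2, \<phi>\<^sub>1 e\<^sub>1, \<dots>\<close> makes the sequence of eigenvalues
  strictly increasing, hence injective.
\<close>

definition product_basis :: "nat \<Rightarrow> 'x \<times> 'x" where
  "product_basis n = (if even n then (\<psi> (n div 2), 0) else (0, \<psi> (n div 2)))"

definition eigenvalue :: "nat \<Rightarrow> real" where
  "eigenvalue n = (if even n then l\<^sub>1 (n div 2) else l\<^sub>2 (n div 2))"

lemma cinner_product_basis:
  "cinner y (product_basis n) = (if even n then X.coeff (fst y) (n div 2) else X.coeff (snd y) (n div 2))"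
  by (simp add: product_basis_def cinner_prod_def cinner_zero_right)

sublocale H: diagonal_operator product_basis D A eigenvalue
proof
  show "cinner (product_basis j) (product_basis k) = (if j = k then 1 else 0)" for j k
  proof -
    have "j = k \<longleftrightarrow> even j = even k \<and> j div 2 = k div 2"
      by (cases "even j"; cases "even k") (auto elim!: evenE oddE, presburger+)
    then show ?thesis
      by (auto simp: product_basis_def cinner_prod_def cinner_zero_left cinner_zero_right)
  qed
  show "x = 0" if x: "\<And>k. cinner x (product_basis k) = 0" for x
  proof -
    have "X.coeff (fst x) k = 0" "X.coeff (snd x) k = 0" for k
      using x[of "2 * k"] x[of "2 * k + 1"] by (simp_all add: cinner_product_basis)
    then show "x = 0"
      using X.complete by (simp add: prod_eq_iff)
  qed
  show "positive_self_adjoint_op D (\<lambda>y. - A y)"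
    by (rule positive_self_adjoint)
  show "product_basis n \<in> D" "A (product_basis n) = - (eigenvalue n *\<^sub>R product_basis n)" for n
    unfolding product_basis_def eigenvalue_def
    using basis_in_domain eigenvector by simp_all
  have "strict_mono eigenvalue"
    unfolding strict_mono_Suc_iff eigenvalue_def using interlaced by (auto elim!: oddE)
  then show "inj eigenvalue"
    by (rule strict_mono_imp_inj_on)
qed

lemma H_coeff: "H.coeff y (2 * k) = X.coeff (fst y) k" "H.coeff y (Suc (2 * k)) = X.coeff (snd y) k"
  by (simp_all add: cinner_product_basis)

lemma eigenvalue_simps: "eigenvalue (2 * k) = l\<^sub>1 k" "eigenvalue (Suc (2 * k)) = l\<^sub>2 k"
  by (simp_all add: eigenvalue_def)

lemma l\<^sub>1_nonneg: "l\<^sub>1 k \<ge> 0"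
  using H.eigenvalue_nonneg[of "2 * k"] by (simp add: eigenvalue_simps)

lemma l\<^sub>1_pos: "k > 0 \<Longrightarrow> l\<^sub>1 k > 0"
  using l\<^sub>1_nonneg[of "k - 1"] interlaced(1)[of "k - 1"] interlaced(2)[of "k - 1"] by simp

lemma l\<^sub>1_ge: "k > 0 \<Longrightarrow> l\<^sub>1 k \<ge> l\<^sub>1 1"
proof (induction k rule: nat_induct_non_zero)
  case (Suc k)
  then show ?case using interlaced[of k] by simp
qed simp

lemma coeff_A_components:
  assumes "y \<in> D"
  shows "X.coeff (fst (A y)) k = - of_real (l\<^sub>1 k) * X.coeff (fst y) k"
    and "X.coeff (snd (A y)) k = - of_real (l\<^sub>2 k) * X.coeff (snd y) k"
  using H.coeff_A[OF assms, of "2 * k"] H.coeff_A[OF assms, of "Suc (2 * k)"]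
  by (simp_all add: H_coeff eigenvalue_simps)

lemma mode_in_domain:
  "(a *\<^sub>R \<psi> k, c *\<^sub>R \<psi> k) \<in> D \<and>
   A (a *\<^sub>R \<psi> k, c *\<^sub>R \<psi> k) = (- (l\<^sub>1 k * a) *\<^sub>R \<psi> k, - (l\<^sub>2 k * c) *\<^sub>R \<psi> k)"
  by (rule H.in_domainI)
    (auto simp: cinner_product_basis eigenvalue_def cinner_scaleR_left cinner_minus_left)

lemma adj_control_op:
  "adj UNIV (control_op b\<^sub>1 b\<^sub>2) y = b\<^sub>1 *\<^sub>R fst y + b\<^sub>2 *\<^sub>R snd y"
  by (rule adj_eqI)
    (simp_all add: control_op_def cinner_prod_def cinner_add_right cinner_scaleR_left cinner_scaleR_right)

lemma norm_prod_square: "(norm (y :: 'x \<times> 'x))\<^sup>2 = (norm (fst y))\<^sup>2 + (norm (snd y))\<^sup>2"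
  by (simp add: norm_prod_def)

text \<open>
  The rate \<open>T\<close> is a time: \<open>exp (- T * l\<^sub>1 k)\<close> is the decay of the slower component of mode \<open>k\<close>
  up to time \<open>T\<close>.
\<close>

definition gap_bound :: "real \<Rightarrow> bool" where
  "gap_bound T \<longleftrightarrow> (\<exists>\<delta>>0. \<forall>k. \<delta> * exp (- T * l\<^sub>1 k) \<le> l\<^sub>2 k - l\<^sub>1 k)"

lemma resolvent_estimate_iff:
  "resolvent_estimate D A (control_op b\<^sub>1 b\<^sub>2) T \<longleftrightarrow>
     (\<exists>C>0. \<forall>y\<in>D. \<forall>\<mu>. Re \<mu> > 0 \<longrightarrow> (norm y)\<^sup>2 \<le> C * exp (2 * T * Re \<mu>) *
       ((norm (A y + \<mu> *\<^sub>C y))\<^sup>2 / (Re \<mu>)\<^sup>2 + (norm (b\<^sub>1 *\<^sub>R fst y + b\<^sub>2 *\<^sub>R snd y))\<^sup>2 / Re \<mu>))"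
  by (simp add: resolvent_estimate_def H.adj_dom_A H.adj_A adj_control_op)

section \<open>Resolvent estimate and gaps\<close>

text \<open>
  If \<open>b\<^sub>1\<close> or \<open>b\<^sub>2\<close> vanishes, an eigenvector and its eigenvalue annihilate the right-hand side.
  The mode with index 1 is taken because the lowest eigenvalue may be 0, whereas the estimate
  concerns positive real parts.
\<close>

lemma control_coefficients_nonzero_if_resolvent_estimate:
  assumes "resolvent_estimate D A (control_op b\<^sub>1 b\<^sub>2) T"
  shows "b\<^sub>1 \<noteq> 0" "b\<^sub>2 \<noteq> 0"
proof -
  from assms obtain C where C: "\<And>y \<mu>. y \<in> D \<Longrightarrow> Re \<mu> > 0 \<Longrightarrow>
      (norm y)\<^sup>2 \<le> C * exp (2 * T * Re \<mu>) *
       ((norm (A y + \<mu> *\<^sub>C y))\<^sup>2 / (Re \<mu>)\<^sup>2 + (norm (b\<^sub>1 *\<^sub>R fst y + b\<^sub>2 *\<^sub>R snd y))\<^sup>2 / Re \<mu>)"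
    unfolding resolvent_estimate_iff by blast
  have pos: "l\<^sub>1 1 > 0" "l\<^sub>2 1 > 0"
    using l\<^sub>1_pos[of 1] interlaced(1)[of 1] by auto
  show "b\<^sub>1 \<noteq> 0"
    using C[OF basis_in_domain(1)[of 1], of "of_real (l\<^sub>1 1)"] pos
    by (auto simp: eigenvector scaleC_of_real norm_prod_square)
  show "b\<^sub>2 \<noteq> 0"
    using C[OF basis_in_domain(2)[of 1], of "of_real (l\<^sub>2 1)"] pos
    by (auto simp: eigenvector scaleC_of_real norm_prod_square)
qed

text \<open>
  The vector \<open>(b\<^sub>2 \<psi>\<^sub>k, - b\<^sub>1 \<psi>\<^sub>k)\<close> is invisible to the observation, and at \<open>\<mu> = l\<^sub>1 k\<close> the resolvent
  term only sees the gap times \<open>b\<^sub>1\<close>. The mode 0, for which \<open>l\<^sub>1 k\<close> may vanish, is accommodated by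
  decreasing the constant.
\<close>

lemma gap_bound_if_resolvent_estimate:
  assumes "resolvent_estimate D A (control_op b\<^sub>1 b\<^sub>2) T"
  shows "gap_bound T"
proof -
  note b = control_coefficients_nonzero_if_resolvent_estimate[OF assms]
  from assms obtain C where "C > 0" and C: "\<And>y \<mu>. y \<in> D \<Longrightarrow> Re \<mu> > 0 \<Longrightarrow>
      (norm y)\<^sup>2 \<le> C * exp (2 * T * Re \<mu>) *
       ((norm (A y + \<mu> *\<^sub>C y))\<^sup>2 / (Re \<mu>)\<^sup>2 + (norm (b\<^sub>1 *\<^sub>R fst y + b\<^sub>2 *\<^sub>R snd y))\<^sup>2 / Re \<mu>)"
    unfolding resolvent_estimate_iff by blast
  define L where "L = l\<^sub>1 1"
  have "L > 0" using l\<^sub>1_pos[of 1] by (simp add: L_def)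
  have large: "L / sqrt C * exp (- T * l\<^sub>1 k) \<le> l\<^sub>2 k - l\<^sub>1 k" if "k > 0" for k
  proof -
    let ?y = "(b\<^sub>2 *\<^sub>R \<psi> k, - b\<^sub>1 *\<^sub>R \<psi> k)" and ?g = "l\<^sub>2 k - l\<^sub>1 k" and ?e = "exp (T * l\<^sub>1 k)"
    have l: "l\<^sub>1 k > 0" "L \<le> l\<^sub>1 k"
      using l\<^sub>1_pos[OF that] l\<^sub>1_ge[OF that] by (simp_all add: L_def)
    have g: "?g > 0" using interlaced(1)[of k] by simp
    have y: "?y \<in> D" and Ay: "A ?y = (- (l\<^sub>1 k * b\<^sub>2) *\<^sub>R \<psi> k, - (l\<^sub>2 k * - b\<^sub>1) *\<^sub>R \<psi> k)"
      using mode_in_domain[of b\<^sub>2 k "- b\<^sub>1"] by blast+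
    have "A ?y + of_real (l\<^sub>1 k) *\<^sub>C ?y = (0, (?g * b\<^sub>1) *\<^sub>R \<psi> k)"
      unfolding Ay scaleC_of_real by (simp add: algebra_simps)
    then have "(norm (A ?y + of_real (l\<^sub>1 k) *\<^sub>C ?y))\<^sup>2 = (?g * b\<^sub>1)\<^sup>2"
      by (simp add: norm_prod_square)
    moreover have "(norm ?y)\<^sup>2 = b\<^sub>1\<^sup>2 + b\<^sub>2\<^sup>2"
      by (simp add: norm_prod_square)
    moreover have "b\<^sub>1 *\<^sub>R fst ?y + b\<^sub>2 *\<^sub>R snd ?y = 0"
      by simp
    moreover have "(norm ?y)\<^sup>2 \<le> C * exp (2 * T * l\<^sub>1 k) *
       ((norm (A ?y + of_real (l\<^sub>1 k) *\<^sub>C ?y))\<^sup>2 / (l\<^sub>1 k)\<^sup>2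
        + (norm (b\<^sub>1 *\<^sub>R fst ?y + b\<^sub>2 *\<^sub>R snd ?y))\<^sup>2 / l\<^sub>1 k)"
      using C[OF y, of "of_real (l\<^sub>1 k)"] l by (simp only: Re_complex_of_real)
    ultimately have est: "b\<^sub>1\<^sup>2 + b\<^sub>2\<^sup>2 \<le> C * exp (2 * T * l\<^sub>1 k) *
       ((?g * b\<^sub>1)\<^sup>2 / (l\<^sub>1 k)\<^sup>2 + (norm (0::'x))\<^sup>2 / l\<^sub>1 k)"
      by (simp only:)
    have "exp (2 * T * l\<^sub>1 k) = ?e\<^sup>2"
      by (simp add: power2_eq_square flip: exp_add)
    moreover have "b\<^sub>1\<^sup>2 \<le> b\<^sub>1\<^sup>2 + b\<^sub>2\<^sup>2"
      by simp
    ultimately have "b\<^sub>1\<^sup>2 * 1 \<le> b\<^sub>1\<^sup>2 * (C * (?e * ?g)\<^sup>2 / (l\<^sub>1 k)\<^sup>2)"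
      using order_trans[OF _ est] by (simp add: power_mult_distrib mult.commute mult.left_commute)
    then have "1 \<le> C * (?e * ?g)\<^sup>2 / (l\<^sub>1 k)\<^sup>2"
      by (rule mult_left_le_imp_le) (use b(1) in simp)
    then have "(l\<^sub>1 k)\<^sup>2 \<le> (sqrt C * (?e * ?g))\<^sup>2"
      using l \<open>C > 0\<close>
      by (simp only: power_mult_distrib[of "sqrt C"] real_sqrt_pow2 less_imp_le pos_le_divide_eq
          zero_less_power mult_1_left)
    then have "l\<^sub>1 k \<le> sqrt C * (?e * ?g)"
      by (rule power2_le_imp_le) (use \<open>C > 0\<close> g in simp)
    with l have "L \<le> sqrt C * (?e * ?g)"
      by simp
    then show ?thesis
      using \<open>C > 0\<close> by (simp add: exp_minus field_simps)
  qed
  show ?thesis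
    unfolding gap_bound_def
  proof (intro exI conjI allI)
    let ?\<delta> = "min (L / sqrt C) ((l\<^sub>2 0 - l\<^sub>1 0) * exp (T * l\<^sub>1 0))"
    show "?\<delta> > 0"
      using \<open>L > 0\<close> \<open>C > 0\<close> interlaced(1)[of 0] by simp
    fix k
    show "?\<delta> * exp (- T * l\<^sub>1 k) \<le> l\<^sub>2 k - l\<^sub>1 k"
    proof (cases "k = 0")
      case True
      have "?\<delta> * exp (- T * l\<^sub>1 k) \<le> (l\<^sub>2 0 - l\<^sub>1 0) * exp (T * l\<^sub>1 0) * exp (- T * l\<^sub>1 k)"
        by (intro mult_right_mono) auto
      also have "\<dots> = l\<^sub>2 k - l\<^sub>1 k"
        using True by (simp add: mult.assoc flip: exp_add)
      finally show ?thesis .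
    next
      case False
      have "?\<delta> * exp (- T * l\<^sub>1 k) \<le> L / sqrt C * exp (- T * l\<^sub>1 k)"
        by (intro mult_right_mono) auto
      with large[of k] False show ?thesis by simp
    qed
  qed
qed

end

text \<open>
  If the resolvent term \<open>R\<close> bounds one component, the observation bounds the other one.
\<close>

lemma mode_bound_if_one_component_bounded:
  fixes a c :: complex and b b' :: real
  assumes "b \<noteq> 0" "r > 0" "E \<ge> 0" "K\<^sub>1 \<ge> 0" "K\<^sub>2 \<ge> 0" "R \<ge> 0"
    and c: "(cmod c)\<^sup>2 \<le> K\<^sub>1 * E * R" and r: "r \<le> K\<^sub>2 * E"
  shows "(cmod a)\<^sup>2 + (cmod c)\<^sup>2 \<le> (K\<^sub>1 + 2 / b\<^sup>2 * (K\<^sub>2 + b'\<^sup>2 * K\<^sub>1)) * E *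
    (R + (cmod (of_real b * a + of_real b' * c))\<^sup>2 / r)"
proof -
  define P where "P = (cmod (of_real b * a + of_real b' * c))\<^sup>2 / r"
  have "P \<ge> 0" using assms by (simp add: P_def)
  have "cmod (of_real b * a) \<le> cmod (of_real b * a + of_real b' * c) + cmod (of_real b' * c)"
    using norm_triangle_ineq4[of "of_real b * a + of_real b' * c" "of_real b' * c"] by simp
  then have "(cmod (of_real b * a))\<^sup>2 \<le> (cmod (of_real b * a + of_real b' * c) + cmod (of_real b' * c))\<^sup>2"
    by (intro power_mono) auto
  also have "\<dots> \<le> 2 * (cmod (of_real b * a + of_real b' * c))\<^sup>2 + 2 * (cmod (of_real b' * c))\<^sup>2"
    by (smt (verit) sum_squares_bound power2_sum)
  finally have "b\<^sup>2 * (cmod a)\<^sup>2 \<le> 2 * (r * P) + 2 * (b'\<^sup>2 * (cmod c)\<^sup>2)"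
    using \<open>r > 0\<close> by (simp add: P_def norm_mult power_mult_distrib)
  also have "\<dots> \<le> 2 * (K\<^sub>2 * E * P) + 2 * (b'\<^sup>2 * (K\<^sub>1 * E * R))"
    using c r \<open>P \<ge> 0\<close> by (intro add_mono mult_left_mono mult_right_mono) auto
  finally have "(cmod a)\<^sup>2 \<le> 2 / b\<^sup>2 * (K\<^sub>2 * E * P + b'\<^sup>2 * (K\<^sub>1 * E * R))"
    using \<open>b \<noteq> 0\<close> by (simp add: field_simps)
  with c have "(cmod a)\<^sup>2 + (cmod c)\<^sup>2 \<le> K\<^sub>1 * E * R + 2 / b\<^sup>2 * (K\<^sub>2 * E * P + b'\<^sup>2 * (K\<^sub>1 * E * R))"
    by linarith
  also have "\<dots> \<le> K\<^sub>1 * E * (R + P) + 2 / b\<^sup>2 * (K\<^sub>2 * E * (R + P) + b'\<^sup>2 * (K\<^sub>1 * E * (R + P)))"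
    using assms \<open>P \<ge> 0\<close> by (intro add_mono mult_left_mono) auto
  also have "\<dots> = (K\<^sub>1 + 2 / b\<^sup>2 * (K\<^sub>2 + b'\<^sup>2 * K\<^sub>1)) * E * (R + P)"
    by (simp add: ring_distribs add_divide_distrib ac_simps)
  finally show ?thesis by (simp add: P_def)
qed

text \<open>
  The resolvent estimate for a single pair \<open>p < q\<close>, with a constant that is the same for
  all pairs with the given gap condition. Let \<open>r = Re \<mu>\<close> and \<open>\<eta> = (T' - T) / 2\<close>. If \<open>r\<close> is well below \<open>p\<close>, both components
  are bounded by the resolvent term alone. Otherwise \<open>T * p \<le> (T' - \<eta>) * r\<close>, so the gap is at
  least \<open>\<delta> * exp (- (T' - \<eta>) * r)\<close>, and \<open>r\<close> is at distance at least half the gap from \<open>p\<close> or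
  from \<open>q\<close>. The spare factor \<open>exp (\<eta> * r) \<ge> \<eta> * r\<close> pays for the division by \<open>r\<close> in the estimate.
\<close>

lemma mode_estimate:
  fixes T T' b\<^sub>1 b\<^sub>2 \<delta> :: real
  assumes T: "0 < T" "T < T'" and b: "b\<^sub>1 \<noteq> 0" "b\<^sub>2 \<noteq> 0" and "\<delta> > 0"
  obtains C where "C > 0"
    "\<And>p q \<mu> a c. 0 \<le> p \<Longrightarrow> \<delta> * exp (- T * p) \<le> q - p \<Longrightarrow> Re \<mu> > 0 \<Longrightarrow>
      (cmod a)\<^sup>2 + (cmod c)\<^sup>2 \<le> C * exp (2 * T' * Re \<mu>) *
        (((cmod ((\<mu> - of_real p) * a))\<^sup>2 + (cmod ((\<mu> - of_real q) * c))\<^sup>2) / (Re \<mu>)\<^sup>2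
         + (cmod (of_real b\<^sub>1 * a + of_real b\<^sub>2 * c))\<^sup>2 / Re \<mu>)"
proof -
  define \<eta> where "\<eta> = (T' - T) / 2"
  \<comment> \<open>Chosen such that \<open>T * (1 + \<sigma>) = T' - \<eta>\<close>.\<close>
  define \<sigma> where "\<sigma> = \<eta> / T"
  define \<kappa> where "\<kappa> = \<delta> * \<eta> / 2"
  define K\<^sub>1 where "K\<^sub>1 = 1 / \<kappa>\<^sup>2"
  define K\<^sub>2 where "K\<^sub>2 = 1 / (2 * T')"
  define C\<^sub>1 where "C\<^sub>1 = K\<^sub>1 + 2 / b\<^sub>1\<^sup>2 * (K\<^sub>2 + b\<^sub>2\<^sup>2 * K\<^sub>1)"
  define C\<^sub>2 where "C\<^sub>2 = K\<^sub>1 + 2 / b\<^sub>2\<^sup>2 * (K\<^sub>2 + b\<^sub>1\<^sup>2 * K\<^sub>1)"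
  define C where "C = 1 / \<sigma>\<^sup>2 + C\<^sub>1 + C\<^sub>2"
  have pos: "\<eta> > 0" "\<sigma> > 0" "\<kappa> > 0" "K\<^sub>1 > 0" "K\<^sub>2 > 0"
    using assms by (simp_all add: \<eta>_def \<sigma>_def \<kappa>_def K\<^sub>1_def K\<^sub>2_def)
  have Cpos: "C\<^sub>1 > 0" "C\<^sub>2 > 0"
    using pos b by (auto simp: C\<^sub>1_def C\<^sub>2_def intro!: add_pos_nonneg)
  have T'': "T' = T + 2 * \<eta>"
    by (simp add: \<eta>_def field_simps)
  show ?thesis
  proof (rule that[of C])
    show "C > 0"
      using Cpos pos by (simp add: C_def add_pos_pos)
    fix p q :: real and \<mu> a c :: complex
    assume p: "0 \<le> p" and gap: "\<delta> * exp (- T * p) \<le> q - p" and r: "Re \<mu> > 0"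
    define r where "r = Re \<mu>"
    define E where "E = exp (2 * T' * r)"
    define R where "R = ((cmod ((\<mu> - of_real p) * a))\<^sup>2 + (cmod ((\<mu> - of_real q) * c))\<^sup>2) / r\<^sup>2"
    define P where "P = (cmod (of_real b\<^sub>1 * a + of_real b\<^sub>2 * c))\<^sup>2 / r"
    have "r > 0" using r by (simp add: r_def)
    have "R \<ge> 0" "P \<ge> 0" "E \<ge> 1"
      using \<open>r > 0\<close> T by (auto simp: R_def P_def E_def)
    have "p < q"
      using gap \<open>\<delta> > 0\<close> by (smt (verit) exp_gt_zero mult_pos_pos)
    have dist: "cmod (\<mu> - of_real s) \<ge> \<bar>r - s\<bar>" for s
      using abs_Re_le_cmod[of "\<mu> - of_real s"] by (simp add: r_def)
    have scaled: "w\<^sup>2 * (cmod z)\<^sup>2 \<le> (cmod ((\<mu> - of_real s) * z))\<^sup>2 / r\<^sup>2"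
      if "0 \<le> w" "w * r \<le> \<bar>r - s\<bar>" for w s and z :: complex
    proof -
      have "(w * r)\<^sup>2 \<le> (cmod (\<mu> - of_real s))\<^sup>2"
        using that dist[of s] \<open>r > 0\<close> by (intro power_mono) auto
      then have "(w * r)\<^sup>2 * (cmod z)\<^sup>2 \<le> (cmod (\<mu> - of_real s))\<^sup>2 * (cmod z)\<^sup>2"
        by (rule mult_right_mono) simp
      then show ?thesis
        using \<open>r > 0\<close> by (simp add: pos_le_divide_eq norm_mult power_mult_distrib mult_ac)
    qed
    have split: "R = (cmod ((\<mu> - of_real p) * a))\<^sup>2 / r\<^sup>2 + (cmod ((\<mu> - of_real q) * c))\<^sup>2 / r\<^sup>2"
      by (simp add: R_def add_divide_distrib)
    have "2 * T' * r \<le> E"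
      using exp_ge_add_one_self[of "2 * T' * r"] unfolding E_def by linarith
    then have rE: "r \<le> K\<^sub>2 * E"
      using T by (simp add: K\<^sub>2_def pos_le_divide_eq mult.commute)
    have "(cmod a)\<^sup>2 + (cmod c)\<^sup>2 \<le> C * E * (R + P)"
    proof (cases "r * (1 + \<sigma>) < p")
      case True
      then have "\<sigma> * r \<le> \<bar>r - p\<bar>" "\<sigma> * r \<le> \<bar>r - q\<bar>"
        using \<open>p < q\<close> by (auto simp: algebra_simps)
      then have "\<sigma>\<^sup>2 * ((cmod a)\<^sup>2 + (cmod c)\<^sup>2) \<le> R"
        using scaled[of \<sigma> p a] scaled[of \<sigma> q c] pos unfolding split
        by (simp add: distrib_left)
      then have "(cmod a)\<^sup>2 + (cmod c)\<^sup>2 \<le> 1 / \<sigma>\<^sup>2 * 1 * R"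
        using pos by (simp add: field_simps)
      also have "\<dots> \<le> C * E * (R + P)"
        using pos Cpos \<open>E \<ge> 1\<close> \<open>R \<ge> 0\<close> \<open>P \<ge> 0\<close> by (intro mult_mono) (auto simp: C_def)
      finally show ?thesis .
    next
      case False
      then have "T * p \<le> T * (r * (1 + \<sigma>))"
        using T by simp
      also have "\<dots> = (T' - \<eta>) * r"
        using T unfolding T'' by (simp add: \<sigma>_def field_simps)
      finally have "\<delta> * exp (- (T' - \<eta>) * r) \<le> q - p"
        using gap \<open>\<delta> > 0\<close> by (smt (verit) exp_le_cancel_iff mult_left_mono mult_minus_left)
      moreover have "\<eta> * r * exp (- T' * r) \<le> exp (\<eta> * r) * exp (- T' * r)"
        using exp_ge_add_one_self[of "\<eta> * r"] by (intro mult_right_mono) (linarith, simp)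
      then have "\<delta> * (\<eta> * r * exp (- T' * r)) \<le> \<delta> * exp (- (T' - \<eta>) * r)"
        using \<open>\<delta> > 0\<close> by (simp add: algebra_simps flip: exp_add)
      ultimately have gap': "2 * (\<kappa> * exp (- T' * r) * r) \<le> q - p"
        by (simp add: \<kappa>_def algebra_simps)
      have w: "(cmod z)\<^sup>2 \<le> K\<^sub>1 * E * R'"
        if "(\<kappa> * exp (- T' * r))\<^sup>2 * (cmod z)\<^sup>2 \<le> R'" for z R'
      proof -
        have "(exp (- T' * r))\<^sup>2 = 1 / E"
          by (simp add: E_def power2_eq_square exp_minus inverse_eq_divide flip: exp_add)
        then have "\<kappa>\<^sup>2 * (1 / E) * (cmod z)\<^sup>2 \<le> R'"
          using that by (simp only: power_mult_distrib)
        then show ?thesis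
          using pos \<open>E \<ge> 1\<close> by (simp add: K\<^sub>1_def field_simps)
      qed
      have le_R: "(cmod ((\<mu> - of_real p) * a))\<^sup>2 / r\<^sup>2 \<le> R" "(cmod ((\<mu> - of_real q) * c))\<^sup>2 / r\<^sup>2 \<le> R"
        by (simp_all add: split)
      have "\<kappa> * exp (- T' * r) * r \<le> \<bar>r - p\<bar> \<or> \<kappa> * exp (- T' * r) * r \<le> \<bar>r - q\<bar>"
        using gap' by linarith
      then have "(cmod a)\<^sup>2 + (cmod c)\<^sup>2 \<le> C\<^sub>1 * E * (R + P) \<or>
        (cmod a)\<^sup>2 + (cmod c)\<^sup>2 \<le> C\<^sub>2 * E * (R + P)"
      proof
        assume "\<kappa> * exp (- T' * r) * r \<le> \<bar>r - p\<bar>"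
        then have "(cmod a)\<^sup>2 \<le> K\<^sub>1 * E * R"
          using scaled[of "\<kappa> * exp (- T' * r)" p a] pos le_R by (intro w) auto
        then have "(cmod c)\<^sup>2 + (cmod a)\<^sup>2 \<le> C\<^sub>2 * E * (R + (cmod (of_real b\<^sub>2 * c + of_real b\<^sub>1 * a))\<^sup>2 / r)"
          unfolding C\<^sub>2_def
          using b \<open>r > 0\<close> \<open>E \<ge> 1\<close> pos \<open>R \<ge> 0\<close> rE
          by (intro mode_bound_if_one_component_bounded) auto
        then show ?thesis by (simp add: P_def add.commute)
      next
        assume "\<kappa> * exp (- T' * r) * r \<le> \<bar>r - q\<bar>"
        then have "(cmod c)\<^sup>2 \<le> K\<^sub>1 * E * R"
          using scaled[of "\<kappa> * exp (- T' * r)" q c] pos le_R by (intro w) auto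
        then have "(cmod a)\<^sup>2 + (cmod c)\<^sup>2 \<le> C\<^sub>1 * E * (R + P)"
          unfolding C\<^sub>1_def P_def
          using b \<open>r > 0\<close> \<open>E \<ge> 1\<close> pos \<open>R \<ge> 0\<close> rE
          by (intro mode_bound_if_one_component_bounded) auto
        then show ?thesis ..
      qed
      moreover have "C\<^sub>i * E * (R + P) \<le> C * E * (R + P)" if "C\<^sub>i \<le> C" for C\<^sub>i
        using that \<open>E \<ge> 1\<close> \<open>R \<ge> 0\<close> \<open>P \<ge> 0\<close> by (intro mult_right_mono) auto
      moreover have "C\<^sub>1 \<le> C" "C\<^sub>2 \<le> C"
        using Cpos pos by (auto simp: C_def)
      ultimately show ?thesis
        by (meson order_trans)
    qed
    then show "(cmod a)\<^sup>2 + (cmod c)\<^sup>2 \<le> C * exp (2 * T' * Re \<mu>) *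
        (((cmod ((\<mu> - of_real p) * a))\<^sup>2 + (cmod ((\<mu> - of_real q) * c))\<^sup>2) / (Re \<mu>)\<^sup>2
         + (cmod (of_real b\<^sub>1 * a + of_real b\<^sub>2 * c))\<^sup>2 / Re \<mu>)"
      by (simp only: E_def R_def P_def r_def)
  qed
qed

context two_component_system begin

lemma resolvent_estimate_if_gap_bound:
  assumes b: "b\<^sub>1 \<noteq> 0" "b\<^sub>2 \<noteq> 0" and T: "0 < T" "T < T'" and gap: "gap_bound T"
  shows "resolvent_estimate D A (control_op b\<^sub>1 b\<^sub>2) T'"
proof -
  from gap obtain \<delta> where "\<delta> > 0" and \<delta>: "\<And>k. \<delta> * exp (- T * l\<^sub>1 k) \<le> l\<^sub>2 k - l\<^sub>1 k"
    unfolding gap_bound_def by blast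
  obtain C where "C > 0" and C:
    "\<And>p q \<mu> a c. 0 \<le> p \<Longrightarrow> \<delta> * exp (- T * p) \<le> q - p \<Longrightarrow> Re \<mu> > 0 \<Longrightarrow>
      (cmod a)\<^sup>2 + (cmod c)\<^sup>2 \<le> C * exp (2 * T' * Re \<mu>) *
        (((cmod ((\<mu> - of_real p) * a))\<^sup>2 + (cmod ((\<mu> - of_real q) * c))\<^sup>2) / (Re \<mu>)\<^sup>2
         + (cmod (of_real b\<^sub>1 * a + of_real b\<^sub>2 * c))\<^sup>2 / Re \<mu>)"
    using mode_estimate[OF T b \<open>\<delta> > 0\<close>] by blast
  show ?thesis
    unfolding resolvent_estimate_iff
  proof (intro exI conjI ballI allI impI)
    show "C > 0" by fact
    fix y and \<mu> :: complex assume y: "y \<in> D" and \<mu>: "Re \<mu> > 0"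
    let ?a = "\<lambda>k. X.coeff (fst y) k" and ?c = "\<lambda>k. X.coeff (snd y) k"
    have 1: "(\<lambda>k. (cmod (?a k))\<^sup>2 + (cmod (?c k))\<^sup>2) sums (norm y)\<^sup>2"
      unfolding norm_prod_square by (intro sums_add X.parseval)
    have "X.coeff (fst (A y + \<mu> *\<^sub>C y)) k = (\<mu> - of_real (l\<^sub>1 k)) * ?a k"
      and "X.coeff (snd (A y + \<mu> *\<^sub>C y)) k = (\<mu> - of_real (l\<^sub>2 k)) * ?c k" for k
      by (simp_all add: scaleC_prod_def cinner_add_left cinner_scaleC_left coeff_A_components[OF y]
          left_diff_distrib)
    then have 2: "(\<lambda>k. (cmod ((\<mu> - of_real (l\<^sub>1 k)) * ?a k))\<^sup>2 + (cmod ((\<mu> - of_real (l\<^sub>2 k)) * ?c k))\<^sup>2)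
        sums (norm (A y + \<mu> *\<^sub>C y))\<^sup>2"
      unfolding norm_prod_square
      using sums_add[OF X.parseval X.parseval, of "fst (A y + \<mu> *\<^sub>C y)" "snd (A y + \<mu> *\<^sub>C y)"]
      by simp
    have 3: "(\<lambda>k. (cmod (of_real b\<^sub>1 * ?a k + of_real b\<^sub>2 * ?c k))\<^sup>2)
        sums (norm (b\<^sub>1 *\<^sub>R fst y + b\<^sub>2 *\<^sub>R snd y))\<^sup>2"
      using X.parseval[of "b\<^sub>1 *\<^sub>R fst y + b\<^sub>2 *\<^sub>R snd y"]
      by (simp add: cinner_add_left cinner_scaleR_left)
    show "(norm y)\<^sup>2 \<le> C * exp (2 * T' * Re \<mu>) *
       ((norm (A y + \<mu> *\<^sub>C y))\<^sup>2 / (Re \<mu>)\<^sup>2 + (norm (b\<^sub>1 *\<^sub>R fst y + b\<^sub>2 *\<^sub>R snd y))\<^sup>2 / Re \<mu>)"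
      by (rule sums_le[OF C[OF l\<^sub>1_nonneg \<delta> \<mu>] 1
            sums_mult[OF sums_add[OF sums_divide[OF 2] sums_divide[OF 3]]]])
  qed
qed

end

section \<open>Null controls\<close>

lemma integrable_lebesgue_on_Ioo_if_continuous:
  fixes f :: "real \<Rightarrow> 'b::{banach, second_countable_topology}"
  assumes "continuous_on {a..b} f"
  shows "integrable (lebesgue_on {a<..<b}) f"
proof -
  have "set_integrable lborel {a..b} f"
    unfolding set_integrable_def by (rule borel_integrable_compact[OF compact_Icc assms])
  then have "set_integrable lborel {a<..<b} f"
    by (rule set_integrable_subset) auto
  then have "integrable lebesgue (\<lambda>x. indicator {a<..<b} x *\<^sub>R f x)"
    unfolding set_integrable_def
    by (subst integrable_completion) (auto dest: borel_measurable_integrable)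
  then show ?thesis
    by (subst integrable_restrict_space) auto
qed

lemma lebesgue_on_Ioo_eq_integral:
  fixes f :: "real \<Rightarrow> real"
  assumes "continuous_on {a..b} f"
  shows "integral\<^sup>L (lebesgue_on {a<..<b}) f = integral {a..b} f"
  by (simp add: lebesgue_integral_eq_integral[OF integrable_lebesgue_on_Ioo_if_continuous[OF assms]]
      integral_open_interval_real)

text \<open>
  The moment of the control profile \<open>s * (T - s)\<close> seen by an eigenvalue \<open>x\<close>. The profile
  vanishes at both ends, so its derivative has no boundary contribution (\<open>derivative_moment\<close>).
\<close>

definition parabola_moment :: "real \<Rightarrow> real \<Rightarrow> real" where
  "parabola_moment T x = integral {0..T} (\<lambda>s. exp (- x * (T - s)) * (s * (T - s)))"

lemma derivative_moment:
  assumes "T \<ge> 0"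
  shows "integral {0..T} (\<lambda>s. exp (- x * (T - s)) * (2 * s - T)) = x * parabola_moment T x"
proof -
  let ?F = "\<lambda>s. exp (- x * (T - s)) * (s * (T - s))"
  let ?G = "\<lambda>s. exp (- x * (T - s)) * (2 * s - T)"
  have "?F integrable_on {0..T}" "?G integrable_on {0..T}"
    by (intro integrable_continuous_real continuous_intros)+
  then have "((\<lambda>s. x * ?F s - ?G s) has_integral x * integral {0..T} ?F - integral {0..T} ?G) {0..T}"
    by (intro has_integral_diff has_integral_mult_right integrable_integral)
  moreover have "((\<lambda>s. x * ?F s - ?G s) has_integral ?F T - ?F 0) {0..T}"
  proof (rule fundamental_theorem_of_calculus[OF assms])
    show "(?F has_vector_derivative x * ?F s - ?G s) (at s within {0..T})" for s
      unfolding has_real_derivative_iff_has_vector_derivative[symmetric]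
      by (auto intro!: derivative_eq_intros simp: algebra_simps)
  qed
  ultimately have "x * integral {0..T} ?F - integral {0..T} ?G = ?F T - ?F 0"
    by (rule has_integral_unique)
  then show ?thesis
    by (simp add: parabola_moment_def)
qed

text \<open>
  Only the times \<open>s\<close> between \<open>T - \<eta>\<close> and \<open>T - \<eta> / 2\<close> are kept. There the exponential is at
  least \<open>exp (- x * \<eta>)\<close>, so dividing the free evolution \<open>exp (- x * T)\<close> by the moment costs only
  an arbitrarily small part \<open>\<eta>\<close> of the time.
\<close>

lemma parabola_moment_ge:
  assumes "0 < \<eta>" "\<eta> < T" "x \<ge> 0"
  shows "(T - \<eta>) * (\<eta> / 2)\<^sup>2 * exp (- x * \<eta>) \<le> parabola_moment T x"
proof -
  let ?F = "\<lambda>s. exp (- x * (T - s)) * (s * (T - s))" and ?I = "{T - \<eta>..T - \<eta> / 2}"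
  have int: "?F integrable_on {c..d}" for c d
    by (intro integrable_continuous_real continuous_intros)
  have "(T - \<eta>) * (\<eta> / 2)\<^sup>2 * exp (- x * \<eta>) = integral ?I (\<lambda>_. exp (- x * \<eta>) * ((T - \<eta>) * (\<eta> / 2)))"
    using assms by (simp add: power2_eq_square)
  also have "\<dots> \<le> integral ?I ?F"
  proof (rule integral_le[OF integrable_const_ivl int])
    fix s assume s: "s \<in> ?I"
    then have "x * (T - s) \<le> x * \<eta>"
      using assms by (intro mult_left_mono) auto
    then show "exp (- x * \<eta>) * ((T - \<eta>) * (\<eta> / 2)) \<le> ?F s"
      using s assms by (intro mult_mono) auto
  qed
  also have "\<dots> \<le> integral {0..T} ?F"
    using assms by (intro integral_subset_le int) auto
  finally show ?thesis by (simp add: parabola_moment_def)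
qed

lemma (in orthonormal_basis) summable_square_if_coeff_bound:
  assumes "\<And>k. cmod (a k) \<le> K * (cmod (coeff x k) + cmod (coeff y k))"
  shows "summable (\<lambda>k. (cmod (a k))\<^sup>2)"
proof (rule summable_comparison_test')
  show "summable (\<lambda>k. 2 * K\<^sup>2 * ((cmod (coeff x k))\<^sup>2 + (cmod (coeff y k))\<^sup>2))"
    by (intro summable_mult summable_add summable_coeff)
  fix k :: nat
  have "(cmod (a k))\<^sup>2 \<le> (K * (cmod (coeff x k) + cmod (coeff y k)))\<^sup>2"
    using assms[of k] by (intro power_mono) auto
  also have "\<dots> \<le> K\<^sup>2 * (2 * ((cmod (coeff x k))\<^sup>2 + (cmod (coeff y k))\<^sup>2))"
    unfolding power_mult_distrib
    by (intro mult_left_mono) (smt (verit) sum_squares_bound power2_sum, simp)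
  finally show "norm ((cmod (a k))\<^sup>2) \<le> 2 * K\<^sup>2 * ((cmod (coeff x k))\<^sup>2 + (cmod (coeff y k))\<^sup>2)"
    by (simp add: algebra_simps)
qed

text \<open>
  Slope and intercept of the line through \<open>(p, z\<^sub>1)\<close> and \<open>(q, z\<^sub>2)\<close>. The divided difference costs
  at most \<open>exp (T\<^sub>0 * p) / \<delta>\<close>, which the decay of \<open>z\<^sub>1\<close> and \<open>z\<^sub>2\<close> compensates; the excess rate \<open>\<epsilon>\<close>
  absorbs the factor \<open>p\<close> in the intercept.
\<close>

lemma interpolation_bound:
  fixes z\<^sub>1 z\<^sub>2 :: complex
  assumes p: "0 \<le> p" and "\<delta> > 0" "\<epsilon> > 0" and gap: "\<delta> * exp (- T\<^sub>0 * p) \<le> q - p"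
    and z: "cmod z\<^sub>1 \<le> r\<^sub>1 * exp (- (T\<^sub>0 + \<epsilon>) * p)" "cmod z\<^sub>2 \<le> r\<^sub>2 * exp (- (T\<^sub>0 + \<epsilon>) * q)"
    and T: "T\<^sub>0 \<ge> 0" and r: "r\<^sub>1 \<ge> 0" "r\<^sub>2 \<ge> 0"
  shows "cmod ((z\<^sub>2 - z\<^sub>1) / of_real (q - p)) \<le> (r\<^sub>1 + r\<^sub>2) / \<delta>"
    and "cmod (z\<^sub>1 - of_real p * ((z\<^sub>2 - z\<^sub>1) / of_real (q - p))) \<le> (1 + 1 / (\<delta> * \<epsilon>)) * (r\<^sub>1 + r\<^sub>2)"
proof -
  have "q > p"
    using gap \<open>\<delta> > 0\<close> by (smt (verit) exp_gt_zero mult_pos_pos)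
  have "r\<^sub>2 * exp (- (T\<^sub>0 + \<epsilon>) * q) \<le> r\<^sub>2 * exp (- (T\<^sub>0 + \<epsilon>) * p)"
    using r T \<open>\<epsilon> > 0\<close> \<open>q > p\<close> by (intro mult_left_mono) auto
  then have "cmod (z\<^sub>2 - z\<^sub>1) \<le> (r\<^sub>1 + r\<^sub>2) * exp (- (T\<^sub>0 + \<epsilon>) * p)"
    using z norm_triangle_ineq4[of z\<^sub>2 z\<^sub>1] by (simp add: distrib_right)
  also have "exp (- (T\<^sub>0 + \<epsilon>) * p) = exp (- \<epsilon> * p) * exp (- T\<^sub>0 * p)"
    by (simp add: algebra_simps flip: exp_add)
  also have "(r\<^sub>1 + r\<^sub>2) * \<dots> = (r\<^sub>1 + r\<^sub>2) * exp (- \<epsilon> * p) / \<delta> * (\<delta> * exp (- T\<^sub>0 * p))"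
    using \<open>\<delta> > 0\<close> by simp
  also have "\<dots> \<le> (r\<^sub>1 + r\<^sub>2) * exp (- \<epsilon> * p) / \<delta> * (q - p)"
    using gap \<open>\<delta> > 0\<close> r by (intro mult_left_mono) auto
  finally have quot: "cmod ((z\<^sub>2 - z\<^sub>1) / of_real (q - p)) \<le> (r\<^sub>1 + r\<^sub>2) * exp (- \<epsilon> * p) / \<delta>"
    using \<open>q > p\<close> by (simp add: norm_divide pos_divide_le_eq del: of_real_diff)
  also have "\<dots> \<le> (r\<^sub>1 + r\<^sub>2) * 1 / \<delta>"
    using p \<open>\<delta> > 0\<close> \<open>\<epsilon> > 0\<close> r by (intro divide_right_mono mult_left_mono) auto
  finally show "cmod ((z\<^sub>2 - z\<^sub>1) / of_real (q - p)) \<le> (r\<^sub>1 + r\<^sub>2) / \<delta>"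
    by simp
  have "\<epsilon> * p \<le> exp (\<epsilon> * p)"
    using exp_ge_add_one_self[of "\<epsilon> * p"] by linarith
  then have decay: "p * exp (- \<epsilon> * p) \<le> 1 / \<epsilon>"
    using \<open>\<epsilon> > 0\<close> by (simp add: exp_minus field_simps)
  have "cmod (of_real p * ((z\<^sub>2 - z\<^sub>1) / of_real (q - p))) \<le> p * ((r\<^sub>1 + r\<^sub>2) * exp (- \<epsilon> * p) / \<delta>)"
    using quot p by (simp only: norm_mult norm_of_real) (intro mult_mono, auto)
  also have "\<dots> = (r\<^sub>1 + r\<^sub>2) / \<delta> * (p * exp (- \<epsilon> * p))"
    by simp
  also have "\<dots> \<le> (r\<^sub>1 + r\<^sub>2) / \<delta> * (1 / \<epsilon>)"
    using r \<open>\<delta> > 0\<close> by (intro mult_left_mono[OF decay]) simp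
  finally have "cmod (of_real p * ((z\<^sub>2 - z\<^sub>1) / of_real (q - p))) \<le> 1 / (\<delta> * \<epsilon>) * (r\<^sub>1 + r\<^sub>2)"
    by simp
  moreover have "0 \<le> (T\<^sub>0 + \<epsilon>) * p"
    using p T \<open>\<epsilon> > 0\<close> by simp
  then have "r\<^sub>1 * exp (- (T\<^sub>0 + \<epsilon>) * p) \<le> r\<^sub>1 * 1"
    using r by (intro mult_left_mono) (simp_all only: mult_minus_left exp_le_one_iff neg_le_0_iff_le)
  then have "cmod z\<^sub>1 \<le> r\<^sub>1 + r\<^sub>2"
    using z(1) r by simp
  ultimately show "cmod (z\<^sub>1 - of_real p * ((z\<^sub>2 - z\<^sub>1) / of_real (q - p))) \<le> (1 + 1 / (\<delta> * \<epsilon>)) * (r\<^sub>1 + r\<^sub>2)"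
    using norm_triangle_ineq4[of z\<^sub>1 "of_real p * ((z\<^sub>2 - z\<^sub>1) / of_real (q - p))"]
    by (simp only: distrib_right mult_1_left)
qed

context two_component_system begin

text \<open>
  The response at time \<open>T\<close> depends on \<open>v\<close> and \<open>w\<close> through the affine function of the eigenvalue
  with intercept \<open>H.coeff v n\<close> and slope \<open>H.coeff w n\<close>; this is what reduces the control problem
  to interpolation.
\<close>

lemma coeff_duhamel_integral:
  assumes "T > 0"
  shows "H.coeff (\<integral>s. H.exp_semigroup (T - s) ((s * (T - s)) *\<^sub>R v + (2 * s - T) *\<^sub>R w)
      \<partial>lebesgue_on {0<..<T}) n =
    of_real (parabola_moment T (eigenvalue n)) * (H.coeff v n + of_real (eigenvalue n) * H.coeff w n)"
proof -
  let ?f = "\<lambda>s. H.exp_semigroup (T - s) ((s * (T - s)) *\<^sub>R v + (2 * s - T) *\<^sub>R w)"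
  let ?x = "eigenvalue n"
  let ?p = "\<lambda>s. exp (- ?x * (T - s)) * (s * (T - s))"
  let ?q = "\<lambda>s. exp (- ?x * (T - s)) * (2 * s - T)"
  have lin: "?f s = (s * (T - s)) *\<^sub>R H.exp_semigroup (T - s) v + (2 * s - T) *\<^sub>R H.exp_semigroup (T - s) w"
    if "s \<le> T" for s
  proof -
    interpret bounded_linear "H.exp_semigroup (T - s)"
      using H.c0_semigroup that by (simp add: c0_semigroup_def)
    show ?thesis by (simp add: add scaleR)
  qed
  have cont: "continuous_on {0..T} (\<lambda>s. H.exp_semigroup (T - s) v)" for v
    by (rule continuous_on_compose2[OF H.continuous_on_semigroup]) (auto intro!: continuous_intros)
  have "continuous_on {0..T} (\<lambda>s. (s * (T - s)) *\<^sub>R H.exp_semigroup (T - s) v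
      + (2 * s - T) *\<^sub>R H.exp_semigroup (T - s) w)"
    by (intro continuous_intros cont)
  then have "continuous_on {0..T} ?f"
    by (rule continuous_on_eq) (simp add: lin)
  then have int: "integrable (lebesgue_on {0<..<T}) ?f"
    by (rule integrable_lebesgue_on_Ioo_if_continuous)
  have cont_pq: "continuous_on {0..T} ?p" "continuous_on {0..T} ?q"
    by (intro continuous_intros)+
  then have int_pq: "integrable (lebesgue_on {0<..<T}) ?p" "integrable (lebesgue_on {0<..<T}) ?q"
    by (intro integrable_lebesgue_on_Ioo_if_continuous; simp)+
  have "H.coeff (integral\<^sup>L (lebesgue_on {0<..<T}) ?f) n
      = (\<integral>s. H.coeff (?f s) n \<partial>lebesgue_on {0<..<T})"
    by (rule integral_bounded_linear[OF bounded_linear_cinner_left int, symmetric])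
  also have "\<dots> = (\<integral>s. of_real (?p s) * H.coeff v n + of_real (?q s) * H.coeff w n \<partial>lebesgue_on {0<..<T})"
  proof (rule Bochner_Integration.integral_cong[OF refl])
    fix s assume "s \<in> space (lebesgue_on {0<..<T})"
    then have s: "0 \<le> T - s"
      by simp
    show "H.coeff (?f s) n = of_real (?p s) * H.coeff v n + of_real (?q s) * H.coeff w n"
      unfolding H.coeff_semigroup[OF s] cinner_add_left cinner_scaleR_left
      by (simp only: of_real_mult distrib_left mult.assoc)
  qed
  also have "\<dots> = (\<integral>s. of_real (?p s) * H.coeff v n \<partial>lebesgue_on {0<..<T})
      + (\<integral>s. of_real (?q s) * H.coeff w n \<partial>lebesgue_on {0<..<T})"
    by (intro Bochner_Integration.integral_add integrable_mult_left integrable_of_real int_pq)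
  also have "\<dots> = of_real (integral\<^sup>L (lebesgue_on {0<..<T}) ?p) * H.coeff v n
      + of_real (integral\<^sup>L (lebesgue_on {0<..<T}) ?q) * H.coeff w n"
    by (simp only: integral_mult_left_zero integral_complex_of_real)
  also have "\<dots> = of_real (parabola_moment T ?x) * H.coeff v n
      + of_real (?x * parabola_moment T ?x) * H.coeff w n"
    using assms by (simp only: lebesgue_on_Ioo_eq_integral[OF cont_pq(1)] lebesgue_on_Ioo_eq_integral[OF cont_pq(2)]
        derivative_moment less_imp_le parabola_moment_def)
  finally show ?thesis
    by (simp add: algebra_simps)
qed

text \<open>
  The free evolution is cancelled in the two components of mode \<open>k\<close> when the line
  \<open>x \<mapsto> \<alpha> k + x * \<beta> k\<close> takes the values \<open>z\<^sub>1 k\<close> and \<open>z\<^sub>2 k\<close> at the two eigenvalues. Half of the time beyond \<open>T\<^sub>0\<close>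
  is spent on the lower bound for the moment, the other half on the interpolation; then \<open>\<alpha>\<close> and
  \<open>\<beta>\<close> are square summable like the coefficients of the initial state.
\<close>

lemma null_controllable_if_gap_bound:
  assumes b: "b\<^sub>1 \<noteq> 0" "b\<^sub>2 \<noteq> 0" and T: "0 < T\<^sub>0" "T\<^sub>0 < T" and gap: "gap_bound T\<^sub>0"
  shows "null_controllable D A (control_op b\<^sub>1 b\<^sub>2) T"
  unfolding null_controllable_def
proof
  fix y\<^sub>0 :: "'x \<times> 'x"
  from gap obtain \<delta> where "\<delta> > 0" and \<delta>: "\<And>k. \<delta> * exp (- T\<^sub>0 * l\<^sub>1 k) \<le> l\<^sub>2 k - l\<^sub>1 k"
    unfolding gap_bound_def by blast
  define \<epsilon> where "\<epsilon> = (T - T\<^sub>0) / 2"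
  define \<kappa> where "\<kappa> = (T - \<epsilon>) * (\<epsilon> / 2)\<^sup>2"
  define M where "M = 1 / (\<bar>b\<^sub>1\<bar> * \<kappa>) + 1 / (\<bar>b\<^sub>2\<bar> * \<kappa>)"
  have \<epsilon>: "0 < \<epsilon>" "\<epsilon> < T" "T = T\<^sub>0 + \<epsilon> + \<epsilon>"
    using T by (simp_all add: \<epsilon>_def field_simps)
  then have "\<kappa> > 0" by (simp add: \<kappa>_def)
  have "M \<ge> 0" using \<open>\<kappa> > 0\<close> by (simp add: M_def)
  define z where "z b x c = - (of_real (exp (- x * T) / (b * parabola_moment T x)) * c)"
    for b x :: real and c :: complex
  have moment_pos: "parabola_moment T x > 0" if "x \<ge> 0" for x
    using parabola_moment_ge[OF \<epsilon>(1,2) that] \<open>\<kappa> > 0\<close>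
    by (smt (verit) \<kappa>_def exp_gt_zero mult_pos_pos)
  have z_bound: "cmod (z b x c) \<le> M * cmod c * exp (- (T\<^sub>0 + \<epsilon>) * x)"
    if x: "x \<ge> 0" and "b = b\<^sub>1 \<or> b = b\<^sub>2" for b x c
  proof -
    have "b \<noteq> 0" "1 / (\<bar>b\<bar> * \<kappa>) \<le> M"
      using that b \<open>\<kappa> > 0\<close> by (auto simp: M_def)
    have "exp (- x * T) / (\<bar>b\<bar> * parabola_moment T x) \<le> exp (- x * T) / (\<bar>b\<bar> * (\<kappa> * exp (- x * \<epsilon>)))"
      using parabola_moment_ge[OF \<epsilon>(1,2) x] \<open>b \<noteq> 0\<close> \<open>\<kappa> > 0\<close> moment_pos[OF x]
      by (intro divide_left_mono mult_left_mono mult_pos_pos) (auto simp: \<kappa>_def)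
    also have "\<dots> = 1 / (\<bar>b\<bar> * \<kappa>) * (exp (- x * T) / exp (- x * \<epsilon>))"
      by simp
    also have "exp (- x * T) / exp (- x * \<epsilon>) = exp (- (T\<^sub>0 + \<epsilon>) * x)"
      unfolding exp_diff[symmetric] \<epsilon>(3) by (simp add: algebra_simps)
    also have "1 / (\<bar>b\<bar> * \<kappa>) * exp (- (T\<^sub>0 + \<epsilon>) * x) \<le> M * exp (- (T\<^sub>0 + \<epsilon>) * x)"
      by (intro mult_right_mono) (fact, simp)
    finally have "exp (- x * T) / (\<bar>b\<bar> * parabola_moment T x) * cmod c
        \<le> M * exp (- (T\<^sub>0 + \<epsilon>) * x) * cmod c"
      by (rule mult_right_mono) simp
    moreover have "cmod (z b x c) = exp (- x * T) / (\<bar>b\<bar> * parabola_moment T x) * cmod c"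
      using moment_pos[OF x] unfolding z_def norm_minus_cancel norm_mult norm_of_real
      by (simp add: abs_mult)
    ultimately show ?thesis
      by (simp add: mult_ac)
  qed
  have l\<^sub>2_nonneg: "l\<^sub>2 k \<ge> 0" for k
    using l\<^sub>1_nonneg[of k] interlaced(1)[of k] by simp
  let ?c = "\<lambda>k. X.coeff (fst y\<^sub>0) k" and ?d = "\<lambda>k. X.coeff (snd y\<^sub>0) k"
  define z\<^sub>1 where "z\<^sub>1 k = z b\<^sub>1 (l\<^sub>1 k) (?c k)" for k
  define z\<^sub>2 where "z\<^sub>2 k = z b\<^sub>2 (l\<^sub>2 k) (?d k)" for k
  define \<beta> where "\<beta> k = (z\<^sub>2 k - z\<^sub>1 k) / of_real (l\<^sub>2 k - l\<^sub>1 k)" for k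
  define \<alpha> where "\<alpha> k = z\<^sub>1 k - of_real (l\<^sub>1 k) * \<beta> k" for k
  have "cmod (z\<^sub>1 k) \<le> M * cmod (?c k) * exp (- (T\<^sub>0 + \<epsilon>) * l\<^sub>1 k)"
    and "cmod (z\<^sub>2 k) \<le> M * cmod (?d k) * exp (- (T\<^sub>0 + \<epsilon>) * l\<^sub>2 k)" for k
    unfolding z\<^sub>1_def z\<^sub>2_def using z_bound l\<^sub>1_nonneg l\<^sub>2_nonneg by blast+
  note bounds = interpolation_bound[OF l\<^sub>1_nonneg \<open>\<delta> > 0\<close> \<epsilon>(1) \<delta> this]
  have "cmod (\<beta> k) \<le> M / \<delta> * (cmod (?c k) + cmod (?d k))" for k
    using bounds(1)[of k] T \<open>M \<ge> 0\<close> by (simp add: \<beta>_def distrib_left add_divide_distrib del: of_real_diff)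
  then have sum_\<beta>: "summable (\<lambda>k. (cmod (\<beta> k))\<^sup>2)"
    by (rule X.summable_square_if_coeff_bound)
  have "cmod (\<alpha> k) \<le> (1 + 1 / (\<delta> * \<epsilon>)) * M * (cmod (?c k) + cmod (?d k))" for k
    using bounds(2)[of k] T \<open>M \<ge> 0\<close>
    by (simp add: \<alpha>_def \<beta>_def distrib_left[of M] mult.assoc del: of_real_diff)
  then have sum_\<alpha>: "summable (\<lambda>k. (cmod (\<alpha> k))\<^sup>2)"
    by (rule X.summable_square_if_coeff_bound)
  define v where "v = (\<Sum>k. \<alpha> k *\<^sub>C \<psi> k)"
  define w where "w = (\<Sum>k. \<beta> k *\<^sub>C \<psi> k)"
  have v: "X.coeff v k = \<alpha> k" and w: "X.coeff w k = \<beta> k" for k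
    unfolding v_def w_def by (rule X.coeff_suminf[OF sum_\<alpha>] X.coeff_suminf[OF sum_\<beta>])+
  have interpolation: "\<alpha> k + of_real (l\<^sub>1 k) * \<beta> k = z\<^sub>1 k" "\<alpha> k + of_real (l\<^sub>2 k) * \<beta> k = z\<^sub>2 k" for k
  proof -
    show "\<alpha> k + of_real (l\<^sub>1 k) * \<beta> k = z\<^sub>1 k"
      by (simp add: \<alpha>_def)
    have "of_real (l\<^sub>2 k - l\<^sub>1 k) * \<beta> k = z\<^sub>2 k - z\<^sub>1 k"
      using interlaced(1)[of k] by (simp add: \<beta>_def del: of_real_diff)
    then show "\<alpha> k + of_real (l\<^sub>2 k) * \<beta> k = z\<^sub>2 k"
      by (simp add: \<alpha>_def algebra_simps)
  qed
  define u where "u s = (s * (T - s)) *\<^sub>R v + (2 * s - T) *\<^sub>R w" for s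
  let ?B = "control_op b\<^sub>1 b\<^sub>2"
  define y where "y t = H.exp_semigroup t y\<^sub>0 + (\<integral>s. H.exp_semigroup (t - s) (?B (u s)) \<partial>lebesgue_on {0<..<t})" for t
  have "L2_control T u"
    unfolding L2_control_def
  proof
    have "continuous_on UNIV u"
      unfolding u_def by (intro continuous_intros)
    then have "continuous_on {0..T} u"
      by (rule continuous_on_subset) simp
    then show "integrable (lebesgue_on {0<..<T}) (\<lambda>t. (norm (u t))\<^sup>2)"
      and "u \<in> borel_measurable (lebesgue_on {0<..<T})"
      by (auto intro!: integrable_lebesgue_on_Ioo_if_continuous continuous_intros
          borel_measurable_integrable)
  qed
  moreover have "mild_solution D A ?B T y\<^sub>0 u y"
    unfolding mild_solution_def y_def
    using H.c0_semigroup H.generates_semigroup by blast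
  moreover have "y T = 0"
  proof (rule H.complete)
    fix n
    have "T > 0" using T by simp
    have B: "?B (u s) = (s * (T - s)) *\<^sub>R ?B v + (2 * s - T) *\<^sub>R ?B w" for s
      by (simp add: u_def control_op_def algebra_simps)
    have "H.coeff (y T) n = of_real (exp (- eigenvalue n * T)) * H.coeff y\<^sub>0 n
        + of_real (parabola_moment T (eigenvalue n)) * (H.coeff (?B v) n + of_real (eigenvalue n) * H.coeff (?B w) n)"
      unfolding y_def B cinner_add_left coeff_duhamel_integral[OF \<open>T > 0\<close>]
      using \<open>T > 0\<close> by (simp only: H.coeff_semigroup less_imp_le)
    also have "\<dots> = 0"
    proof (cases "even n")
      case True
      then obtain k where n: "n = 2 * k" by blast
      have "H.coeff (?B v) n + of_real (eigenvalue n) * H.coeff (?B w) n = of_real b\<^sub>1 * z\<^sub>1 k"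
        unfolding n H_coeff eigenvalue_simps interpolation(1)[symmetric]
        by (simp add: control_op_def cinner_scaleR_left v w algebra_simps)
      moreover have "of_real (parabola_moment T (l\<^sub>1 k)) * (of_real b\<^sub>1 * z\<^sub>1 k)
          = - of_real (exp (- l\<^sub>1 k * T)) * ?c k"
        using moment_pos[OF l\<^sub>1_nonneg[of k]] b by (simp add: z\<^sub>1_def z_def)
      ultimately show ?thesis
        by (simp add: n H_coeff eigenvalue_simps)
    next
      case False
      then obtain k where n: "n = Suc (2 * k)" by (auto elim: oddE)
      have "H.coeff (?B v) n + of_real (eigenvalue n) * H.coeff (?B w) n = of_real b\<^sub>2 * z\<^sub>2 k"
        unfolding n H_coeff eigenvalue_simps interpolation(2)[symmetric]
        by (simp add: control_op_def cinner_scaleR_left v w algebra_simps)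
      moreover have "of_real (parabola_moment T (l\<^sub>2 k)) * (of_real b\<^sub>2 * z\<^sub>2 k)
          = - of_real (exp (- l\<^sub>2 k * T)) * ?d k"
        using moment_pos[OF l\<^sub>2_nonneg[of k]] b by (simp add: z\<^sub>2_def z_def)
      ultimately show ?thesis
        by (simp add: n H_coeff eigenvalue_simps)
    qed
    finally show "H.coeff (y T) n = 0" .
  qed
  ultimately show "\<exists>u y. L2_control T u \<and> mild_solution D A ?B T y\<^sub>0 u y \<and> y T = 0"
    by blast
qed

end

context two_component_system begin

section \<open>Gaps from null controllability\<close>

text \<open>
  Null controllability as a moment problem. If the Duhamel integrand is not integrable, its
  integral is 0 by convention; then the free evolution already vanishes at time \<open>T\<close>, which
  forces \<open>y\<^sub>0 = 0\<close>, and for \<open>y\<^sub>0 = 0\<close> the zero control solves the moment problem.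
\<close>

lemma moments_if_null_controllable:
  assumes "null_controllable D A (control_op b\<^sub>1 b\<^sub>2) T" "T > 0"
  shows "\<exists>u. L2_control T u \<and>
    (\<forall>k. of_real (exp (- l\<^sub>1 k * T)) * X.coeff (fst y\<^sub>0) k + of_real b\<^sub>1 *
      (\<integral>s. of_real (exp (- l\<^sub>1 k * (T - s))) * X.coeff (u s) k \<partial>lebesgue_on {0<..<T}) = 0) \<and>
    (\<forall>k. of_real (exp (- l\<^sub>2 k * T)) * X.coeff (snd y\<^sub>0) k + of_real b\<^sub>2 *
      (\<integral>s. of_real (exp (- l\<^sub>2 k * (T - s))) * X.coeff (u s) k \<partial>lebesgue_on {0<..<T}) = 0)"
proof (cases "y\<^sub>0 = 0")
  case True
  have "L2_control T (\<lambda>_. 0::'x)"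
    by (simp add: L2_control_def)
  then show ?thesis
    by (intro exI[of _ "\<lambda>_. 0"]) (simp add: True cinner_zero_left)
next
  case False
  from assms obtain u y S where u: "L2_control T u" and S: "c0_semigroup S" "generates D A S"
    and y: "y T = S T y\<^sub>0 + (\<integral>s. S (T - s) (control_op b\<^sub>1 b\<^sub>2 (u s)) \<partial>lebesgue_on {0<..<T})" "y T = 0"
    unfolding null_controllable_def mild_solution_def by fastforce
  let ?f = "\<lambda>s. S (T - s) (control_op b\<^sub>1 b\<^sub>2 (u s))"
  have S_coeff: "H.coeff (S t x) n = of_real (exp (- eigenvalue n * t)) * H.coeff x n" if "t \<ge> 0" for t x n
    by (rule H.coeff_generated_semigroup[OF S that])
  have int: "integrable (lebesgue_on {0<..<T}) ?f"
  proof (rule ccontr)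
    assume "\<not> integrable (lebesgue_on {0<..<T}) ?f"
    then have "S T y\<^sub>0 = 0"
      using y by (simp add: not_integrable_integral_eq)
    then have "H.coeff y\<^sub>0 n = 0" for n
      using S_coeff[of T y\<^sub>0 n] \<open>T > 0\<close> by (simp add: cinner_zero_left)
    then show False
      using H.complete False by blast
  qed
  have eq: "of_real (exp (- eigenvalue n * T)) * H.coeff y\<^sub>0 n
      + (\<integral>s. of_real (exp (- eigenvalue n * (T - s))) * H.coeff (control_op b\<^sub>1 b\<^sub>2 (u s)) n \<partial>lebesgue_on {0<..<T}) = 0" for n
  proof -
    have "0 = H.coeff (S T y\<^sub>0) n + H.coeff (integral\<^sup>L (lebesgue_on {0<..<T}) ?f) n"
      using y by (simp add: cinner_zero_left flip: cinner_add_left)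
    also have "H.coeff (integral\<^sup>L (lebesgue_on {0<..<T}) ?f) n
        = (\<integral>s. H.coeff (?f s) n \<partial>lebesgue_on {0<..<T})"
      by (rule integral_bounded_linear[OF bounded_linear_cinner_left int, symmetric])
    also have "\<dots> = (\<integral>s. of_real (exp (- eigenvalue n * (T - s))) * H.coeff (control_op b\<^sub>1 b\<^sub>2 (u s)) n
        \<partial>lebesgue_on {0<..<T})"
      by (intro Bochner_Integration.integral_cong refl S_coeff) simp
    finally show ?thesis
      using S_coeff[of T y\<^sub>0 n] \<open>T > 0\<close> by simp
  qed
  show ?thesis
  proof (intro exI[of _ u] conjI allI u)
    fix k
    show "of_real (exp (- l\<^sub>1 k * T)) * X.coeff (fst y\<^sub>0) k
      + of_real b\<^sub>1 * (\<integral>s. of_real (exp (- l\<^sub>1 k * (T - s))) * X.coeff (u s) k \<partial>lebesgue_on {0<..<T}) = 0"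
      using eq[of "2 * k"]
      by (simp add: H_coeff eigenvalue_simps control_op_def cinner_scaleR_left mult.left_commute[of _ "of_real b\<^sub>1"])
    show "of_real (exp (- l\<^sub>2 k * T)) * X.coeff (snd y\<^sub>0) k
      + of_real b\<^sub>2 * (\<integral>s. of_real (exp (- l\<^sub>2 k * (T - s))) * X.coeff (u s) k \<partial>lebesgue_on {0<..<T}) = 0"
      using eq[of "Suc (2 * k)"]
      by (simp add: H_coeff eigenvalue_simps control_op_def cinner_scaleR_left mult.left_commute[of _ "of_real b\<^sub>2"])
  qed
qed

lemma control_coefficients_nonzero_if_null_controllable:
  assumes "null_controllable D A (control_op b\<^sub>1 b\<^sub>2) T" "T > 0"
  shows "b\<^sub>1 \<noteq> 0" "b\<^sub>2 \<noteq> 0"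
proof -
  obtain u where "L2_control T u" and
    u: "\<And>k. of_real (exp (- l\<^sub>1 k * T)) * X.coeff (fst (\<psi> 0, \<psi> 0)) k
      + of_real b\<^sub>1 * (\<integral>s. of_real (exp (- l\<^sub>1 k * (T - s))) * X.coeff (u s) k \<partial>lebesgue_on {0<..<T}) = 0"
     "\<And>k. of_real (exp (- l\<^sub>2 k * T)) * X.coeff (snd (\<psi> 0, \<psi> 0)) k
      + of_real b\<^sub>2 * (\<integral>s. of_real (exp (- l\<^sub>2 k * (T - s))) * X.coeff (u s) k \<partial>lebesgue_on {0<..<T}) = 0"
    using moments_if_null_controllable[OF assms, of "(\<psi> 0, \<psi> 0)"] by blast
  show "b\<^sub>1 \<noteq> 0"
    using u(1)[of 0] by auto
  show "b\<^sub>2 \<noteq> 0"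
    using u(2)[of 0] by auto
qed

text \<open>
  The bound is uniform in the mode \<open>k\<close>, which is the point of comparing a coefficient with the
  norm of \<open>u\<close>.
\<close>

lemma L2_control_weighted_coeff:
  fixes u :: "real \<Rightarrow> 'x" and g :: "real \<Rightarrow> real"
  assumes u: "L2_control T u" and g: "continuous_on UNIV g"
    and G: "\<And>s. 0 < s \<Longrightarrow> s < T \<Longrightarrow> \<bar>g s\<bar> \<le> G" and "G \<ge> 0"
  shows "integrable (lebesgue_on {0<..<T}) (\<lambda>s. of_real (g s) * X.coeff (u s) k)"
    and "cmod (\<integral>s. of_real (g s) * X.coeff (u s) k \<partial>lebesgue_on {0<..<T})
      \<le> G * (\<integral>s. 1 + (norm (u s))\<^sup>2 \<partial>lebesgue_on {0<..<T})"
proof -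
  let ?M = "lebesgue_on {0<..<T}"
  let ?h = "\<lambda>s. G * (1 + (norm (u s))\<^sup>2)"
  have [measurable]: "u \<in> borel_measurable ?M" and int: "integrable ?M (\<lambda>s. (norm (u s))\<^sup>2)"
    using u by (simp_all add: L2_control_def)
  have one: "integrable ?M (\<lambda>_. 1 :: real)"
    by (rule integrable_lebesgue_on_Ioo_if_continuous) simp
  then have int1: "integrable ?M (\<lambda>s. 1 + (norm (u s))\<^sup>2)"
    using int by (rule Bochner_Integration.integrable_add)
  then have dom: "integrable ?M ?h"
    by (rule integrable_mult_right)
  have "g \<in> borel_measurable lborel"
    using borel_measurable_continuous_onI[OF g] by simp
  then have [measurable]: "g \<in> borel_measurable ?M"
    by (intro measurable_restrict_space1 measurable_completion)
  have [measurable]: "(\<lambda>x. X.coeff x k) \<in> borel_measurable borel"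
    by (rule borel_measurable_continuous_onI) (intro continuous_on_cinner_left continuous_intros)
  have meas: "(\<lambda>s. of_real (g s) * X.coeff (u s) k) \<in> borel_measurable ?M"
    by measurable
  have bound: "cmod (of_real (g s) * X.coeff (u s) k) \<le> ?h s" if "s \<in> space ?M" for s
  proof -
    have "2 * norm (u s) \<le> 1 + (norm (u s))\<^sup>2"
      using sum_squares_bound[of 1 "norm (u s)"] by simp
    then have "cmod (X.coeff (u s) k) \<le> 1 + (norm (u s))\<^sup>2"
      using X.cmod_coeff_le[of "u s" k] norm_ge_zero[of "u s"] by linarith
    then show ?thesis
      using G[of s] that \<open>G \<ge> 0\<close> by (simp only: norm_mult norm_of_real) (intro mult_mono, auto)
  qed
  show int_g: "integrable ?M (\<lambda>s. of_real (g s) * X.coeff (u s) k)"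
    using dom meas
  proof (rule Bochner_Integration.integrable_bound)
    show "AE s in ?M. norm (of_real (g s) * X.coeff (u s) k) \<le> norm (?h s)"
      using bound \<open>G \<ge> 0\<close> by (intro AE_I2) (simp add: order_trans[OF _ abs_ge_self])
  qed
  have "cmod (\<integral>s. of_real (g s) * X.coeff (u s) k \<partial>?M) \<le> (\<integral>s. ?h s \<partial>?M)"
    by (rule Bochner_Integration.integral_norm_bound_integral[OF int_g dom bound])
  then show "cmod (\<integral>s. of_real (g s) * X.coeff (u s) k \<partial>?M) \<le> G * (\<integral>s. 1 + (norm (u s))\<^sup>2 \<partial>?M)"
    by simp
qed

lemma exp_minus_diff_le:
  fixes p q t :: real
  assumes "0 \<le> p" "p \<le> q" "0 \<le> t"
  shows "\<bar>exp (- p * t) - exp (- q * t)\<bar> \<le> (q - p) * t"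
proof -
  have le: "exp (- q * t) \<le> exp (- p * t)"
    using assms by (simp add: mult_right_mono)
  have "exp (- p * t) - exp (- q * t) = exp (- p * t) * (1 - exp (- ((q - p) * t)))"
    by (simp add: algebra_simps flip: exp_add)
  also have "\<dots> \<le> 1 * (1 - exp (- ((q - p) * t)))"
    using assms by (intro mult_right_mono) auto
  also have "\<dots> \<le> (q - p) * t"
    using exp_ge_add_one_self[of "- ((q - p) * t)"] by simp
  finally show ?thesis
    using le by simp
qed

text \<open>
  If the gaps of some modes \<open>m j\<close> are smaller than \<open>4 ^ (- j)\<close> times the dissipation, take an
  initial state with first component \<open>\<Sum>j. 2 ^ (- j) \<psi> (m j)\<close> and second component 0. The moment
  of the control against the slow exponential equals its moment against the difference of the
  two exponentials, which is too small to compensate the coefficient \<open>2 ^ (- j)\<close> for large \<open>j\<close>.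
\<close>

lemma gap_bound_if_null_controllable:
  assumes nc: "null_controllable D A (control_op b\<^sub>1 b\<^sub>2) T" and "T > 0"
  shows "gap_bound T"
proof (rule ccontr)
  assume "\<not> gap_bound T"
  then have "\<exists>k. l\<^sub>2 k - l\<^sub>1 k < \<delta> * exp (- T * l\<^sub>1 k)" if "\<delta> > 0" for \<delta>
    using that by (force simp: gap_bound_def not_le)
  then have "\<exists>k. l\<^sub>2 k - l\<^sub>1 k < (1 / 4) ^ j * exp (- T * l\<^sub>1 k)" for j :: nat
    by simp
  then obtain m where m: "\<And>j::nat. l\<^sub>2 (m j) - l\<^sub>1 (m j) < (1 / 4) ^ j * exp (- T * l\<^sub>1 (m j))"
    by metis
  define y where "y = (\<Sum>j. (1 / 2 :: real) ^ j *\<^sub>R \<psi> (m j))"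
  have summable: "summable (\<lambda>j. (1 / 2 :: real) ^ j *\<^sub>R \<psi> (m j))"
    by (rule summable_norm_cancel) (simp add: summable_geometric)
  \<comment> \<open>Repetitions among the \<open>m j\<close> only increase the coefficients.\<close>
  have y_coeff: "(1 / 2) ^ j \<le> cmod (X.coeff y (m j))" for j
  proof -
    have inner: "inner (\<psi> i) (\<psi> k) = (if i = k then 1 else 0)" for i k
      by (simp add: Re_cinner[symmetric])
    have "(1 / 2) ^ j = (\<Sum>i\<in>{j}. inner ((1 / 2) ^ i *\<^sub>R \<psi> (m i)) (\<psi> (m j)))"
      by (simp add: inner)
    also have "\<dots> \<le> (\<Sum>i. inner ((1 / 2) ^ i *\<^sub>R \<psi> (m i)) (\<psi> (m j)))"
      by (rule sum_le_suminf[OF bounded_linear.summable[OF bounded_linear_inner_left summable]])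
        (auto simp: inner)
    also have "\<dots> = inner y (\<psi> (m j))"
      unfolding y_def by (rule bounded_linear.suminf[OF bounded_linear_inner_left summable, symmetric])
    also have "\<dots> \<le> cmod (X.coeff y (m j))"
      unfolding Re_cinner[symmetric] by (rule complex_Re_le_cmod)
    finally show ?thesis .
  qed
  obtain u where u: "L2_control T u" and
    u1: "\<And>k. of_real (exp (- l\<^sub>1 k * T)) * X.coeff (fst (y, 0 :: 'x)) k
      + of_real b\<^sub>1 * (\<integral>s. of_real (exp (- l\<^sub>1 k * (T - s))) * X.coeff (u s) k \<partial>lebesgue_on {0<..<T}) = 0"
    and u2: "\<And>k. of_real (exp (- l\<^sub>2 k * T)) * X.coeff (snd (y, 0 :: 'x)) k
      + of_real b\<^sub>2 * (\<integral>s. of_real (exp (- l\<^sub>2 k * (T - s))) * X.coeff (u s) k \<partial>lebesgue_on {0<..<T}) = 0"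
    using moments_if_null_controllable[OF assms, of "(y, 0)"] by blast
  define M where "M = (\<integral>s. 1 + (norm (u s))\<^sup>2 \<partial>lebesgue_on {0<..<T})"
  have "M \<ge> 0"
    unfolding M_def by (rule integral_nonneg_AE) auto
  have "2 ^ j \<le> \<bar>b\<^sub>1\<bar> * T * M" for j :: nat
  proof -
    let ?k = "m j" and ?I = "\<lambda>x. (\<integral>s. of_real (exp (- x * (T - s))) * X.coeff (u s) (m j) \<partial>lebesgue_on {0<..<T})"
    define p where "p = l\<^sub>1 (m j)"
    define q where "q = l\<^sub>2 (m j)"
    have pq: "0 \<le> p" "p \<le> q"
      using l\<^sub>1_nonneg[of ?k] interlaced(1)[of ?k] by (simp_all add: p_def q_def)
    have int: "integrable (lebesgue_on {0<..<T}) (\<lambda>s. of_real (exp (- x * (T - s))) * X.coeff (u s) ?k)"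
      if "x \<ge> 0" for x
      by (rule L2_control_weighted_coeff(1)[OF u, of _ 1]) (use that in \<open>auto intro!: continuous_intros\<close>)
    have "?I q = 0"
      using u2[of ?k] control_coefficients_nonzero_if_null_controllable(2)[OF assms]
      by (simp add: q_def cinner_zero_left)
    then have "?I p = ?I p - ?I q"
      by simp
    also have "\<dots> = (\<integral>s. of_real (exp (- p * (T - s)) - exp (- q * (T - s))) * X.coeff (u s) ?k \<partial>lebesgue_on {0<..<T})"
      using pq int[of p] int[of q] by (simp add: left_diff_distrib Bochner_Integration.integral_diff)
    also have "cmod \<dots> \<le> (q - p) * T * M"
      unfolding M_def
    proof (rule L2_control_weighted_coeff(2)[OF u])
      fix s assume "0 < s" "s < T"
      then have "(q - p) * (T - s) \<le> (q - p) * T"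
        using pq by (intro mult_left_mono) auto
      then show "\<bar>exp (- p * (T - s)) - exp (- q * (T - s))\<bar> \<le> (q - p) * T"
        using exp_minus_diff_le[OF pq, of "T - s"] \<open>s < T\<close> by simp
    qed (use pq \<open>T > 0\<close> in \<open>auto intro!: continuous_intros\<close>)
    also have "\<dots> \<le> (1 / 4) ^ j * exp (- T * p) * T * M"
      using m[of j] \<open>T > 0\<close> \<open>M \<ge> 0\<close> unfolding p_def q_def by (intro mult_right_mono) auto
    finally have I: "cmod (?I p) \<le> (1 / 4) ^ j * exp (- T * p) * T * M" .
    have "of_real (exp (- p * T)) * X.coeff y ?k = - (of_real b\<^sub>1 * ?I p)"
      using u1[of ?k] unfolding p_def fst_conv by (simp only: eq_neg_iff_add_eq_0)
    then have "cmod (of_real (exp (- p * T)) * X.coeff y ?k) = cmod (of_real b\<^sub>1 * ?I p)"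
      by (simp only: norm_minus_cancel)
    then have "exp (- p * T) * cmod (X.coeff y ?k) = \<bar>b\<^sub>1\<bar> * cmod (?I p)"
      by (simp only: norm_mult norm_of_real abs_exp_cancel)
    then have "exp (- p * T) * (1 / 2) ^ j \<le> \<bar>b\<^sub>1\<bar> * ((1 / 4) ^ j * exp (- T * p) * T * M)"
      using y_coeff[of j] I by (smt (verit) exp_ge_zero abs_ge_zero mult_left_mono)
    then have "exp (- p * T) * (1 / 2) ^ j \<le> exp (- p * T) * ((1 / 4) ^ j * (\<bar>b\<^sub>1\<bar> * T * M))"
      by (simp add: mult_ac)
    then have "(1 / 2) ^ j \<le> (1 / 4) ^ j * (\<bar>b\<^sub>1\<bar> * T * M)"
      by (rule mult_left_le_imp_le) simp
    then have "4 ^ j * (1 / 2) ^ j \<le> 4 ^ j * ((1 / 4) ^ j * (\<bar>b\<^sub>1\<bar> * T * M))"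
      by (rule mult_left_mono) simp
    then show ?thesis
      by (simp only: mult.assoc[symmetric] power_mult_distrib[symmetric]) simp
  qed
  moreover obtain j where "\<bar>b\<^sub>1\<bar> * T * M < 2 ^ j"
    using real_arch_pow[of 2 "\<bar>b\<^sub>1\<bar> * T * M"] by auto
  ultimately show False
    by (meson not_le)
qed

section \<open>The time threshold\<close>

lemma resolvent_estimate_if_null_controllable:
  assumes "null_controllable D A (control_op b\<^sub>1 b\<^sub>2) T" "0 < T" "T < T'"
  shows "resolvent_estimate D A (control_op b\<^sub>1 b\<^sub>2) T'"
  by (rule resolvent_estimate_if_gap_bound[OF control_coefficients_nonzero_if_null_controllable[OF assms(1,2)]
        assms(2,3) gap_bound_if_null_controllable[OF assms(1,2)]])

lemma T_star_le_if_null_controllable: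
  assumes "null_controllable D A (control_op b\<^sub>1 b\<^sub>2) T" "0 < T"
  shows "T_star D A (control_op b\<^sub>1 b\<^sub>2) \<le> ereal T"
proof (rule ccontr)
  assume "\<not> ?thesis"
  then obtain T' where "T < T'" and T': "ereal T' < T_star D A (control_op b\<^sub>1 b\<^sub>2)"
    using ereal_dense2[of "ereal T"] by (auto simp: not_le)
  then have "resolvent_estimate D A (control_op b\<^sub>1 b\<^sub>2) T'"
    by (intro resolvent_estimate_if_null_controllable[OF assms])
  then have "T_star D A (control_op b\<^sub>1 b\<^sub>2) \<le> ereal T'"
    using \<open>0 < T\<close> \<open>T < T'\<close> unfolding T_star_def by (intro Inf_lower) auto
  with T' show False by simp
qed

lemma null_controllable_if_T_star_less:
  assumes "T_star D A (control_op b\<^sub>1 b\<^sub>2) < ereal T"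
  shows "null_controllable D A (control_op b\<^sub>1 b\<^sub>2) T"
proof -
  from assms obtain T\<^sub>0 where T: "0 < T\<^sub>0" "T\<^sub>0 < T"
    and est: "resolvent_estimate D A (control_op b\<^sub>1 b\<^sub>2) T\<^sub>0"
    by (auto simp: T_star_def Inf_less_iff)
  show ?thesis
    by (rule null_controllable_if_gap_bound[OF control_coefficients_nonzero_if_resolvent_estimate[OF est]
          T gap_bound_if_resolvent_estimate[OF est]])
qed

end

theorem proposition4p3:
  fixes D :: "('x::{complex_hilbert, second_countable_topology} \<times> 'x) set"
    and A :: "'x \<times> 'x \<Rightarrow> 'x \<times> 'x"
    and \<phi> :: "nat \<Rightarrow> 'x"
    and ev :: "nat \<Rightarrow> nat \<Rightarrow> real"
    and b\<^sub>1 b\<^sub>2 :: real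
  assumes "positive_self_adjoint_op D (\<lambda>y. - A y)"
    and "hilbert_basis_on {1..} \<phi>"
    and "\<And>k i. k \<ge> 1 \<Longrightarrow> i \<in> {1, 2} \<Longrightarrow>
           comp_vec (\<phi> k) i \<in> D \<and>
           - A (comp_vec (\<phi> k) i) = complex_of_real (ev k i) *\<^sub>C comp_vec (\<phi> k) i"
    and "\<And>k. k \<ge> 1 \<Longrightarrow> ev k 1 < ev k 2 \<and> ev k 2 < ev (k + 1) 1"
  shows "(\<forall>T::real. 0 < T \<and> 0 < T_star D A (control_op b\<^sub>1 b\<^sub>2) \<and> ereal T < T_star D A (control_op b\<^sub>1 b\<^sub>2)
            \<longrightarrow> \<not> null_controllable D A (control_op b\<^sub>1 b\<^sub>2) T) \<and>
         (\<forall>T::real. 0 < T \<and> T_star D A (control_op b\<^sub>1 b\<^sub>2) < \<infinity> \<and> T_star D A (control_op b\<^sub>1 b\<^sub>2) < ereal T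
            \<longrightarrow> null_controllable D A (control_op b\<^sub>1 b\<^sub>2) T)"
proof -
  interpret orthonormal_basis "\<lambda>k. \<phi> (Suc k)"
    by (rule orthonormal_basis_if_hilbert_basis_on[OF assms(2)])
  interpret two_component_system "\<lambda>k. \<phi> (Suc k)" D A "\<lambda>k. ev (Suc k) 1" "\<lambda>k. ev (Suc k) 2" b\<^sub>1 b\<^sub>2
  proof
    show "positive_self_adjoint_op D (\<lambda>y. - A y)" by fact
    fix k
    have e1: "(\<phi> (Suc k), 0) \<in> D" "- A (\<phi> (Suc k), 0) = ev (Suc k) 1 *\<^sub>R (\<phi> (Suc k), 0)"
      and e2: "(0, \<phi> (Suc k)) \<in> D" "- A (0, \<phi> (Suc k)) = ev (Suc k) 2 *\<^sub>R (0, \<phi> (Suc k))"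
      using assms(3)[of "Suc k" 1] assms(3)[of "Suc k" 2] unfolding scaleC_of_real
      by (simp_all only: comp_vec_def) auto
    show "(\<phi> (Suc k), 0) \<in> D" "(0, \<phi> (Suc k)) \<in> D"
      by (fact e1(1), fact e2(1))
    show "A (\<phi> (Suc k), 0) = - (ev (Suc k) 1 *\<^sub>R (\<phi> (Suc k), 0))"
      "A (0, \<phi> (Suc k)) = - (ev (Suc k) 2 *\<^sub>R (0, \<phi> (Suc k)))"
      by (metis e1(2) minus_minus, metis e2(2) minus_minus)
    show "ev (Suc k) 1 < ev (Suc k) 2" "ev (Suc k) 2 < ev (Suc (Suc k)) 1"
      using assms(4)[of "Suc k"] by simp_all
  qed
  show ?thesis
    using T_star_le_if_null_controllable null_controllable_if_T_star_less
    by (auto simp: not_less[symmetric])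
qed

end
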